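(* There exists an absolute constant $c>0$ such that the following holds. Let $n\ge2$, $\mu\in\mathbb{R}^n$, $\sigma>0$, $\xi\sim\mathcal{N}(0,\sigma^2I_{n\times n})$ and $y=\mu+\xi$. Then for any $x>0$, with probability greater than $1-\exp(-x)$, $$\|\hat\mu^{LS}(\mathcal{S}_n^\uparrow)-\mu\|^2\le\min_{u\in\mathcal{S}_n^\uparrow}\left[\|u-\mu\|^2+2c\,\sigma^2\left(\frac{\sigma+V(u)}{\sigma n}\right)^{2/3}\right]+\frac{4\sigma^2x}{n}.$$
   Context: Scaled norm: $\|v\|^2=\frac1n\sum_{i=1}^n v_i^2$ for $v\in\mathbb{R}^n$. $\mathcal{S}_n^\uparrow=\{u\in\mathbb{R}^n: u_i\le u_{i+1},\ i=1,\dots,n-1\}$. $V(u)=\max_{i}u_i-\min_iu_i$ for $u\in\mathbb{R}^n$. The least squares estimator over a nonempty closed set $K$ is $\hat\mu^{LS}(K)\in\operatorname{argmin}_{v\in K}\|y-v\|^2$. *)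

theory Defs
  imports "HOL-Probability.Probability"
begin

text \<open>
  The dimension \<open>n\<close> must be quantified inside the scope of the absolute constant, so it
  cannot be a type. A vector of \<open>n\<close> real coordinates is a function on the index
  set \<open>{1..n}\<close>, extended by \<open>undefined\<close>; this is also the underlying space of
  the product measure on \<open>{1..n}\<close>.
\<close>

definition Rn :: "nat \<Rightarrow> (nat \<Rightarrow> real) set" where
  "Rn n = {1..n} \<rightarrow>\<^sub>E UNIV"

definition vadd :: "nat \<Rightarrow> (nat \<Rightarrow> real) \<Rightarrow> (nat \<Rightarrow> real) \<Rightarrow> (nat \<Rightarrow> real)" where
  "vadd n v w = (\<lambda>i\<in>{1..n}. v i + w i)"

definition vdiff :: "nat \<Rightarrow> (nat \<Rightarrow> real) \<Rightarrow> (nat \<Rightarrow> real) \<Rightarrow> (nat \<Rightarrow> real)" where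
  "vdiff n v w = (\<lambda>i\<in>{1..n}. v i - w i)"

definition scaled_norm :: "nat \<Rightarrow> (nat \<Rightarrow> real) \<Rightarrow> real" where
  "scaled_norm n v = sqrt (1 / real n * (\<Sum>i=1..n. (v i)\<^sup>2))"

definition S_up :: "nat \<Rightarrow> (nat \<Rightarrow> real) set" where
  "S_up n = {u \<in> Rn n. \<forall>i\<in>{1..<n}. u i \<le> u (i + 1)}"

definition V :: "nat \<Rightarrow> (nat \<Rightarrow> real) \<Rightarrow> real" where
  "V n u = Max (u ` {1..n}) - Min (u ` {1..n})"

definition LSE :: "nat \<Rightarrow> (nat \<Rightarrow> real) set \<Rightarrow> (nat \<Rightarrow> real) \<Rightarrow> (nat \<Rightarrow> real)" where
  "LSE n K y = arg_min_on (\<lambda>v. (scaled_norm n (vdiff n y v))\<^sup>2) K"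

text \<open>
  The minimum of \<open>f\<close> over a possibly infinite set (\<^const>\<open>Min\<close> only covers finite ones).
  It is the value at a minimiser, hence specified only if the minimum is attained.
\<close>

definition min_over :: "('a \<Rightarrow> real) \<Rightarrow> 'a set \<Rightarrow> real" where
  "min_over f A = f (arg_min_on f A)"

text \<open>
  The law of a centred Gaussian vector with covariance \<open>\<sigma>\<^sup>2 I\<close>; the parameter of
  \<^const>\<open>normal_density\<close> is the standard deviation. Probabilities of events that depend on the
  noise only are taken under this law, so that the absolute constant is not tied to the type
  of some sample space; \<open>distr_eq_gaussian_noise\<close> and \<open>prob_eq_gaussian_noise\<close> below carry them
  over to any probability space.
\<close>

definition gaussian_noise :: "nat \<Rightarrow> real \<Rightarrow> (nat \<Rightarrow> real) measure" where
  "gaussian_noise n \<sigma> =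
     (\<Pi>\<^sub>M i\<in>{1..n}. density lborel (\<lambda>t. ennreal (normal_density 0 \<sigma> t)))"

lemma space_gaussian_noise: "space (gaussian_noise n \<sigma>) = Rn n"
  by (simp add: gaussian_noise_def Rn_def space_PiM)

lemma sets_gaussian_noise: "sets (gaussian_noise n \<sigma>) = sets (\<Pi>\<^sub>M i\<in>{1..n}. borel)"
  unfolding gaussian_noise_def by (intro sets_PiM_cong) auto

lemma (in prob_space) distr_eq_gaussian_noise:
  assumes "n \<ge> 1"
    and indep: "indep_vars (\<lambda>_. borel) X {1..n}"
    and normal: "\<And>i. i \<in> {1..n} \<Longrightarrow> distributed M lborel (X i) (normal_density 0 \<sigma>)"
  shows "distr M (\<Pi>\<^sub>M i\<in>{1..n}. borel) (\<lambda>\<omega>. \<lambda>i\<in>{1..n}. X i \<omega>) = gaussian_noise n \<sigma>"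
proof -
  have rv: "random_variable borel (X i)" if "i \<in> {1..n}" for i
    using indep that by (auto simp: indep_vars_def)
  have "distr M (\<Pi>\<^sub>M i\<in>{1..n}. borel) (\<lambda>\<omega>. \<lambda>i\<in>{1..n}. X i \<omega>)
      = (\<Pi>\<^sub>M i\<in>{1..n}. distr M borel (X i))"
    using indep_vars_iff_distr_eq_PiM'[where I = "{1..n}" and M' = "\<lambda>_. borel" and X = X] rv indep \<open>n \<ge> 1\<close> by auto
  also have "\<dots> = gaussian_noise n \<sigma>"
    unfolding gaussian_noise_def
  proof (intro PiM_cong refl)
    fix i assume i: "i \<in> {1..n}"
    have "distr M borel (X i) = distr M lborel (X i)"
      by (intro distr_cong) auto
    also have "\<dots> = density lborel (normal_density 0 \<sigma>)"
      using normal[OF i] by (rule distributed_distr_eq_density)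
    finally show "distr M borel (X i) = density lborel (normal_density 0 \<sigma>)" .
  qed
  finally show ?thesis .
qed

lemma (in prob_space) prob_eq_gaussian_noise:
  assumes "n \<ge> 1"
    and indep: "indep_vars (\<lambda>_. borel) X {1..n}"
    and normal: "\<And>i. i \<in> {1..n} \<Longrightarrow> distributed M lborel (X i) (normal_density 0 \<sigma>)"
    and meas: "{z \<in> space (gaussian_noise n \<sigma>). P z} \<in> sets (gaussian_noise n \<sigma>)"
  shows "\<P>(\<omega> in M. P (\<lambda>i\<in>{1..n}. X i \<omega>)) = \<P>(z in gaussian_noise n \<sigma>. P z)"
proof -
  have rv: "random_variable borel (X i)" if "i \<in> {1..n}" for i
    using indep that by (auto simp: indep_vars_def)
  let ?N = "\<Pi>\<^sub>M i\<in>{1..n}. (borel :: real measure)"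
  let ?X = "\<lambda>\<omega>. \<lambda>i\<in>{1..n}. X i \<omega>"
  have X: "?X \<in> measurable M ?N"
    using rv by (intro measurable_restrict) auto
  have "\<P>(z in gaussian_noise n \<sigma>. P z) = measure (distr M ?N ?X) {z \<in> Rn n. P z}"
    using distr_eq_gaussian_noise[OF assms(1-3)] by (simp add: space_gaussian_noise)
  also have "\<dots> = measure M (?X -` {z \<in> Rn n. P z} \<inter> space M)"
    using X meas by (intro measure_distr) (auto simp: space_gaussian_noise sets_gaussian_noise)
  also have "?X -` {z \<in> Rn n. P z} \<inter> space M = {\<omega> \<in> space M. P (?X \<omega>)}"
    by (auto simp: Rn_def)
  finally show ?thesis by simp
qed

end

theory Submission
  imports Defs
begin

text \<open>
  Let \<open>u\<close> minimise the right-hand side and let \<open>K\<close> be the cone of monotone vectors. Since the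
  estimator is a projection onto a convex set, \<open>n\<close> times the excess loss over \<open>u\<close> is at most
  \<open>Z = sup {2 \<langle>\<xi>, v - u\<rangle> - |v - u|\<^sup>2 : v \<in> K}\<close>, with the Euclidean inner product.

  Concentration: convexity gives \<open>Z x \<le> 3 Z y + 3/2 |x - y|\<^sup>2\<close> (compare with \<open>v\<close> moved to
  \<open>u + (v - u) / 3\<close>), so the Prekopa-Leindler inequality with weights 1/4 and 3/4 yields
  \<open>E exp (Z / 4\<sigma>\<^sup>2) \<le> exp (3/4 E Z / \<sigma>\<^sup>2)\<close>, and Markov's inequality gives the term \<open>4 \<sigma>\<^sup>2 x / n\<close>.

  Size of \<open>E Z\<close>: expand noise and signal in a Haar basis. At scale \<open>2\<^sup>l\<close> the coefficients of
  \<open>v - u\<close> have absolute sum at most \<open>2\<^bsup>l/2\<^esup>\<close> times the variation. Scales above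
  \<open>(n / (1 + V/\<sigma>))\<^bsup>2/3\<^esup>\<close> contribute one unit per block; below, soft thresholding at a level
  growing linearly with the depth makes the contributions a convergent series, so that no
  logarithmic factor appears.
\<close>

section \<open>The Prekopa-Leindler inequality for Gaussian measures\<close>

text \<open>The obstacle is that the competitors \<open>v\<close> have unlimited variation, so a
  bound on the Haar coefficients of \<open>v - u\<close> by variation is empty at first. The
  quadratic penalty repairs this: if \<open>v\<close> leaves the range of \<open>u\<close> by
  \<omega> already before the last \<open>k\<close> indices, those indices alone cost
  \<open>k\<close> times the square of \<omega>. Half of the penalty is reserved for this and half
  pays for the noise. All terms balance at one number m = n^(1/3) (1 + V/\<sigma>)^(2/3): about m
  outer indices, about m coarse blocks, and a variation cost of order m.

  The quantity Z has quadratic growth and no global Lipschitz constant, which rules out Lipschitz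
  concentration and suggests Prekopa-Leindler. That inequality accepts one function of the noise at
  x and another at y. So the supremum is never formed: the excess loss \<open>W\<close> of the
  estimator is paired with an explicit measurable majorant \<open>R\<close> of known mean, and no
  uncountable supremum has to be measured. The exponent keeps only 3/4 of the mean; the spare
  quarter makes the probability bound strict.\<close>

text \<open>Handles at once a supremum that is attained, not attained or infinite. Each cut lies
  below some element of \<open>A\<close>, so that a bound for cuts at elements applies to
  it.\<close>

lemma exhausting_upper_cuts:
  fixes A :: "real set"
  assumes "A \<noteq> {}"
  shows "\<exists>t::nat \<Rightarrow> real. incseq t \<and> A \<subseteq> (\<Union>n. {..t n}) \<and> (\<forall>n. \<exists>a\<in>A. t n \<le> a)"
proof (cases "bdd_above A")
  case False
  have "\<exists>a\<in>A. real n \<le> a" for n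
    using False by (auto simp: bdd_above_def not_le intro: less_imp_le)
  moreover have "A \<subseteq> (\<Union>n. {..real n})"
    using real_arch_simple by auto
  ultimately show ?thesis
    by (intro exI[of _ real]) (auto simp: incseq_def)
next
  case True
  define s where "s = Sup A"
  have s: "a \<le> s" if "a \<in> A" for a
    using True that by (simp add: s_def cSup_upper)
  show ?thesis
  proof (cases "s \<in> A")
    case True
    then show ?thesis
      using s by (intro exI[of _ "\<lambda>_. s"]) auto
  next
    case False
    define t where "t = (\<lambda>n. s - 1 / real (Suc n))"
    have "incseq t"
      by (auto simp: incseq_def t_def field_simps)
    moreover have "A \<subseteq> (\<Union>n. {..t n})"
    proof
      fix a assume "a \<in> A"
      then have "a < s" using s False by (metis less_eq_real_def)
      then obtain n where "1 / real (Suc n) < s - a"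
        using nat_approx_posE[of "s - a"] by (auto simp del: of_nat_Suc)
      then show "a \<in> (\<Union>n. {..t n})"
        by (auto simp: t_def simp del: of_nat_Suc intro!: exI[of _ n])
    qed
    moreover have "\<exists>a\<in>A. t n \<le> a" for n
    proof -
      have "t n < Sup A" by (simp add: t_def s_def)
      then show ?thesis
        using less_cSup_iff[OF assms \<open>bdd_above A\<close>] by (auto intro: less_imp_le)
    qed
    ultimately show ?thesis by blast
  qed
qed

text \<open>If \<open>A\<close> ends at \<open>a\<close> and \<open>B\<close> starts at
  \<open>b\<close>, the translates of \<open>A\<close> by \<open>b\<close> and of \<open>B\<close>
  by \<open>a\<close> both lie in \<open>C\<close> and meet at most in \<open>a + b\<close>. General
  sets are exhausted by such truncations.\<close>

lemma brunn_minkowski_real: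
  fixes A B C :: "real set"
  assumes [measurable]: "A \<in> sets borel" "B \<in> sets borel" "C \<in> sets borel"
    and "A \<noteq> {}" "B \<noteq> {}"
    and AB: "\<And>a b. a \<in> A \<Longrightarrow> b \<in> B \<Longrightarrow> a + b \<in> C"
  shows "emeasure lborel A + emeasure lborel B \<le> emeasure lborel C"
proof -
  have cut: "emeasure lborel (A \<inter> {..a}) + emeasure lborel (B \<inter> {b..}) \<le> emeasure lborel C"
    if "a \<in> A" "b \<in> B" for a b
  proof -
    define A' where "A' = (\<lambda>x. x - b) -` (A \<inter> {..a})"
    \<comment> \<open>The half-line is open so that the two translates are disjoint; the lost point
      \<open>b\<close> has measure zero.\<close>
    define B' where "B' = (\<lambda>x. x - a) -` (B \<inter> {b<..})"
    have [measurable]: "A' \<in> sets borel" "B' \<in> sets borel"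
      unfolding A'_def B'_def by (auto intro!: measurable_sets_borel[where f="\<lambda>x. x - _"])
    have shift: "emeasure lborel ((\<lambda>x. x - c) -` S) = emeasure lborel S" if "S \<in> sets borel" for c S
    proof -
      have "emeasure lborel S = emeasure (distr lborel borel (\<lambda>x. - c + x)) S"
        by (subst lborel_distr_plus) simp
      also have "\<dots> = emeasure lborel ((\<lambda>x. - c + x) -` S \<inter> space lborel)"
        using that by (intro emeasure_distr) auto
      finally show ?thesis by simp
    qed
    have "emeasure lborel (B \<inter> {b..}) \<le> emeasure lborel ((B \<inter> {b<..}) \<union> {b})"
      by (intro emeasure_mono) auto
    also have "\<dots> \<le> emeasure lborel (B \<inter> {b<..}) + emeasure lborel {b}"
      by (intro emeasure_subadditive) auto
    finally have "emeasure lborel (B \<inter> {b..}) \<le> emeasure lborel (B \<inter> {b<..})"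
      by simp
    then have "emeasure lborel (A \<inter> {..a}) + emeasure lborel (B \<inter> {b..})
        \<le> emeasure lborel A' + emeasure lborel B'"
      unfolding A'_def B'_def by (subst (1 2) shift) auto
    also have "\<dots> = emeasure lborel (A' \<union> B')"
      by (intro plus_emeasure) (auto simp: A'_def B'_def)
    also have "\<dots> \<le> emeasure lborel C"
    proof (intro emeasure_mono)
      show "A' \<union> B' \<subseteq> C"
        using AB[of _ b] AB[of a] that unfolding A'_def B'_def by force
    qed auto
    finally show ?thesis .
  qed
  obtain t where t: "incseq t" "A \<subseteq> (\<Union>n. {..t n})" "\<And>n::nat. \<exists>a\<in>A. t n \<le> a"
    using exhausting_upper_cuts[OF \<open>A \<noteq> {}\<close>] by blast
  obtain r where r: "incseq r" "uminus ` B \<subseteq> (\<Union>n. {..r n})" "\<And>n::nat. \<exists>b\<in>B. r n \<le> - b"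
    using exhausting_upper_cuts[of "uminus ` B"] \<open>B \<noteq> {}\<close> by auto
  have r': "B \<subseteq> (\<Union>n. {- r n..})"
  proof
    fix b assume "b \<in> B"
    then obtain n where "- b \<le> r n" using r(2) by blast
    then show "b \<in> (\<Union>n. {- r n..})" by (auto intro!: exI[of _ n])
  qed
  have "(\<lambda>n. emeasure lborel (A \<inter> {..t n})) \<longlonglongrightarrow> emeasure lborel (\<Union>n. A \<inter> {..t n})"
    using t(1) by (intro Lim_emeasure_incseq) (auto simp: incseq_def intro: order_trans)
  moreover have "(\<Union>n. A \<inter> {..t n}) = A" using t(2) by blast
  moreover have "(\<lambda>n. emeasure lborel (B \<inter> {- r n..})) \<longlonglongrightarrow> emeasure lborel (\<Union>n. B \<inter> {- r n..})"
    using r(1) by (intro Lim_emeasure_incseq) (auto simp: incseq_def, meson neg_le_iff_le order_trans)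
  moreover have "(\<Union>n. B \<inter> {- r n..}) = B" using r' by blast
  ultimately have "(\<lambda>n. emeasure lborel (A \<inter> {..t n}) + emeasure lborel (B \<inter> {- r n..}))
      \<longlonglongrightarrow> emeasure lborel A + emeasure lborel B"
    by (auto intro: tendsto_add)
  moreover have "emeasure lborel (A \<inter> {..t n}) + emeasure lborel (B \<inter> {- r n..}) \<le> emeasure lborel C" for n
  proof -
    obtain a b where "a \<in> A" "t n \<le> a" "b \<in> B" "r n \<le> - b" using t(3) r(3) by blast
    then have "emeasure lborel (A \<inter> {..t n}) + emeasure lborel (B \<inter> {- r n..})
        \<le> emeasure lborel (A \<inter> {..a}) + emeasure lborel (B \<inter> {b..})"
      by (intro add_mono emeasure_mono) auto
    also have "\<dots> \<le> emeasure lborel C" using \<open>a \<in> A\<close> \<open>b \<in> B\<close> by (rule cut)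
    finally show ?thesis .
  qed
  ultimately show ?thesis
    by (intro LIMSEQ_le_const2) auto
qed

text \<open>Only levels below 1 are kept, because only there are the superlevel sets of both
  normalised functions certain to be nonempty. The minimum with 1 accommodates \<open>h\<close>,
  which may exceed 1.\<close>

lemma nn_integral_layer_cake_unit:
  fixes f :: "real \<Rightarrow> real"
  assumes [measurable]: "f \<in> borel_measurable borel" and "\<And>x. 0 \<le> f x"
  shows "(\<integral>\<^sup>+x. ennreal (min 1 (f x)) \<partial>lborel) = (\<integral>\<^sup>+s\<in>{0<..<1}. emeasure lborel {x. s < f x} \<partial>lborel)"
proof -
  have "(\<integral>\<^sup>+x. ennreal (min 1 (f x)) \<partial>lborel)
      = (\<integral>\<^sup>+x. (\<integral>\<^sup>+s. indicator {0<..<1} s * indicator {x. s < f x} x \<partial>lborel) \<partial>lborel)"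
  proof (intro nn_integral_cong)
    fix x
    have "(\<integral>\<^sup>+s. indicator {0<..<1} s * indicator {x. s < f x} x \<partial>lborel)
        = (\<integral>\<^sup>+s. indicator {0<..<min 1 (f x)} s \<partial>lborel)"
      by (intro nn_integral_cong) (auto simp: indicator_def)
    also have "\<dots> = ennreal (min 1 (f x))"
      using assms(2)[of x] by simp
    finally show "ennreal (min 1 (f x)) = (\<integral>\<^sup>+s. indicator {0<..<1} s * indicator {x. s < f x} x \<partial>lborel)"
      by simp
  qed
  also have "\<dots> = (\<integral>\<^sup>+s. (\<integral>\<^sup>+x. indicator {0<..<1} s * indicator {x. s < f x} x \<partial>lborel) \<partial>lborel)"
    by (rule lborel_pair.Fubini') measurable
  also have "\<dots> = (\<integral>\<^sup>+s\<in>{0<..<1}. emeasure lborel {x. s < f x} \<partial>lborel)"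
  proof (intro nn_integral_cong)
    fix s :: real
    have "(\<integral>\<^sup>+x. indicator {0<..<1} s * indicator {x. s < f x} x \<partial>lborel)
        = indicator {0<..<1} s * (\<integral>\<^sup>+x. indicator {x. s < f x} x \<partial>lborel)"
      by (rule nn_integral_cmult) measurable
    also have "(\<integral>\<^sup>+x. indicator {x. s < f x} x \<partial>lborel) = emeasure lborel {x. s < f x}"
      by (rule nn_integral_indicator) measurable
    finally show "(\<integral>\<^sup>+x. indicator {0<..<1} s * indicator {x. s < f x} x \<partial>lborel)
        = emeasure lborel {x. s < f x} * indicator {0<..<1} s"
      by (simp add: mult.commute)
  qed
  finally show ?thesis .
qed

lemma emeasure_lborel_scale_vimage:
  fixes S :: "real set"
  assumes "S \<in> sets borel" "c > 0"
  shows "emeasure lborel ((\<lambda>x. x / c) -` S) = ennreal c * emeasure lborel S"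
proof -
  have eq: "lborel = density (distr lborel borel (\<lambda>x. 0 + inverse c * x)) (\<lambda>_. ennreal \<bar>inverse c\<bar>)"
    using assms by (intro lborel_real_affine) auto
  have "emeasure lborel S = (\<integral>\<^sup>+x. indicator S x \<partial>(density (distr lborel borel (\<lambda>x. 0 + inverse c * x)) (\<lambda>_. ennreal \<bar>inverse c\<bar>)))"
    using assms by (subst eq[symmetric]) simp
  also have "\<dots> = ennreal (inverse c) * emeasure lborel ((\<lambda>x. x / c) -` S)"
  proof -
    have "(\<lambda>x. inverse c * x) -` S = (\<lambda>x. x / c) -` S" by (auto simp: field_simps)
    moreover have "emeasure (distr lborel borel (\<lambda>x. inverse c * x)) S = emeasure lborel ((\<lambda>x. inverse c * x) -` S)"
      using assms by (subst emeasure_distr) auto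
    ultimately show ?thesis using assms
      by (subst nn_integral_density) (auto simp: nn_integral_cmult)
  qed
  finally have "ennreal c * emeasure lborel S = ennreal c * ennreal (inverse c) * emeasure lborel ((\<lambda>x. x / c) -` S)"
    by (simp add: mult.assoc)
  then show ?thesis using assms by (simp flip: ennreal_mult)
qed

text \<open>Brunn-Minkowski is applied level by level to superlevel sets scaled by 1/4 and 3/4. It
  fails for empty sets, hence the requirement that both suprema equal 1. Fourth powers in the
  hypothesis stand for the weights and avoid fractional exponents.\<close>

lemma prekopa_leindler_sup_one:
  fixes f g h :: "real \<Rightarrow> real"
  assumes [measurable]: "f \<in> borel_measurable borel" "g \<in> borel_measurable borel" "h \<in> borel_measurable borel"
    and f: "\<And>x. 0 \<le> f x" "\<And>x. f x \<le> 1" "\<And>s. s < 1 \<Longrightarrow> \<exists>x. s < f x"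
    and g: "\<And>x. 0 \<le> g x" "\<And>x. g x \<le> 1" "\<And>s. s < 1 \<Longrightarrow> \<exists>x. s < g x"
    and h: "\<And>x. 0 \<le> h x" "\<And>x y. f x * g y ^ 3 \<le> h ((x + 3 * y) / 4) ^ 4"
  shows "ennreal (1/4) * (\<integral>\<^sup>+x. f x \<partial>lborel) + ennreal (3/4) * (\<integral>\<^sup>+x. g x \<partial>lborel) \<le> (\<integral>\<^sup>+x. h x \<partial>lborel)"
proof -
  have pre: "(\<lambda>x. x / c) -` {x. s < k x} \<in> sets borel"
    if [measurable]: "k \<in> borel_measurable borel" for c s :: real and k :: "real \<Rightarrow> real"
    unfolding vimage_Collect_eq by measurable
  have level: "ennreal (1/4) * emeasure lborel {x. s < f x} + ennreal (3/4) * emeasure lborel {x. s < g x}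
      \<le> emeasure lborel {x. s < h x}" if s: "0 < s" "s < 1" for s
  proof -
    have "emeasure lborel ((\<lambda>x. x / (1/4)) -` {x. s < f x}) + emeasure lborel ((\<lambda>x. x / (3/4)) -` {x. s < g x})
      \<le> emeasure lborel {x. s < h x}"
    proof (rule brunn_minkowski_real)
      obtain x y where "s < f x" "s < g y" using f(3) g(3) s by blast
      then have "x / 4 \<in> (\<lambda>x. x / (1/4)) -` {x. s < f x}" "3 * y / 4 \<in> (\<lambda>x. x / (3/4)) -` {x. s < g x}"
        by auto
      then show "(\<lambda>x. x / (1/4)) -` {x. s < f x} \<noteq> {}" "(\<lambda>x. x / (3/4)) -` {x. s < g x} \<noteq> {}"
        by blast+
    next
      fix a b assume a: "a \<in> (\<lambda>x. x / (1/4)) -` {x. s < f x}" and b: "b \<in> (\<lambda>x. x / (3/4)) -` {x. s < g x}"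
      have "s ^ 4 = s * s ^ 3" by (simp add: power_numeral_reduce)
      also have "\<dots> < f (4 * a) * g (4 * b / 3) ^ 3"
        using a b s by (intro mult_strict_mono power_strict_mono) (auto simp: ac_simps)
      also have "\<dots> \<le> h ((4 * a + 3 * (4 * b / 3)) / 4) ^ 4" by (rule h(2))
      also have "(4 * a + 3 * (4 * b / 3)) / 4 = a + b" by (simp add: field_simps)
      finally have "s < h (a + b)" using h(1) power_less_imp_less_base by blast
      then show "a + b \<in> {x. s < h x}" by simp
    next
      show "{x. s < h x} \<in> sets borel" by measurable
    qed (rule pre, rule assms)+
    then show ?thesis by (subst (asm) (1 2) emeasure_lborel_scale_vimage) auto
  qed
  have "ennreal (1/4) * (\<integral>\<^sup>+x. f x \<partial>lborel) + ennreal (3/4) * (\<integral>\<^sup>+x. g x \<partial>lborel)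
      = ennreal (1/4) * (\<integral>\<^sup>+s\<in>{0<..<1}. emeasure lborel {x. s < f x} \<partial>lborel)
        + ennreal (3/4) * (\<integral>\<^sup>+s\<in>{0<..<1}. emeasure lborel {x. s < g x} \<partial>lborel)"
    using f g by (simp flip: nn_integral_layer_cake_unit add: min_absorb2)
  also have "\<dots> = (\<integral>\<^sup>+s. ennreal (1/4) * (emeasure lborel {x. s < f x} * indicator {0<..<1} s)
        + ennreal (3/4) * (emeasure lborel {x. s < g x} * indicator {0<..<1} s) \<partial>lborel)"
    by (simp add: nn_integral_add nn_integral_cmult)
  also have "\<dots> \<le> (\<integral>\<^sup>+s\<in>{0<..<1}. emeasure lborel {x. s < h x} \<partial>lborel)"
    using level by (intro nn_integral_mono) (auto simp: indicator_def)
  also have "\<dots> = (\<integral>\<^sup>+x. ennreal (min 1 (h x)) \<partial>lborel)"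
    using h by (simp add: nn_integral_layer_cake_unit)
  also have "\<dots> \<le> (\<integral>\<^sup>+x. h x \<partial>lborel)"
    by (intro nn_integral_mono ennreal_leI) auto
  finally show ?thesis .
qed


lemma weighted_am_gm_four:
  fixes a b :: real
  assumes "0 \<le> a" "0 \<le> b"
  shows "a * b ^ 3 \<le> ((a + 3 * b) / 4) ^ 4"
proof -
  have "((a + 3 * b) / 4) ^ 4 - a * b ^ 3 = (a - b)\<^sup>2 * (a\<^sup>2 + 14 * a * b + 81 * b\<^sup>2) / 256"
    by (simp add: field_simps power2_eq_square power3_eq_cube power4_eq_xxxx)
  also have "\<dots> \<ge> 0" using assms by simp
  finally show ?thesis by simp
qed

text \<open>Dividing by the suprema reduces to the normalised case, whose conclusion is an
  arithmetic mean; weighted AM-GM turns it into the product.\<close>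

lemma prekopa_leindler_bounded:
  fixes f g h :: "real \<Rightarrow> real"
  assumes [measurable]: "f \<in> borel_measurable borel" "g \<in> borel_measurable borel" "h \<in> borel_measurable borel"
    and f: "\<And>x. 0 \<le> f x" "\<And>x. f x \<le> A"
    and g: "\<And>x. 0 \<le> g x" "\<And>x. g x \<le> B"
    and h: "\<And>x. 0 \<le> h x" "\<And>x y. f x * g y ^ 3 \<le> h ((x + 3 * y) / 4) ^ 4"
  shows "(\<integral>\<^sup>+x. f x \<partial>lborel) * (\<integral>\<^sup>+x. g x \<partial>lborel) ^ 3 \<le> (\<integral>\<^sup>+x. h x \<partial>lborel) ^ 4"
proof -
  define a b where "a = Sup (range f)" and "b = Sup (range g)"
  have bdd: "bdd_above (range f)" "bdd_above (range g)"
    using f g by (auto simp: bdd_above_def)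
  have fa: "f x \<le> a" and gb: "g x \<le> b" for x
    using bdd by (auto simp: a_def b_def intro!: cSup_upper)
  have fa': "\<exists>x. s < f x" if "s < a" for s
    using that less_cSup_iff[OF _ bdd(1)] by (auto simp: a_def)
  have gb': "\<exists>x. s < g x" if "s < b" for s
    using that less_cSup_iff[OF _ bdd(2)] by (auto simp: b_def)
  have "0 \<le> a" "0 \<le> b" using fa[of 0] f(1)[of 0] gb[of 0] g(1)[of 0] by auto
  then consider "a = 0" | "b = 0" | "a > 0" "b > 0" by linarith
  then show ?thesis
  proof cases
    case 1
    then have "f x = 0" for x using fa[of x] f(1)[of x] by simp
    then show ?thesis by simp
  next
    case 2
    then have "g x = 0" for x using gb[of x] g(1)[of x] by simp
    then show ?thesis by simp
  next
    case 3
    \<comment> \<open>The normalisation of \<open>h\<close> that keeps the pointwise hypothesis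
      unchanged after \<open>f\<close> and \<open>g\<close> are divided by \<open>a\<close> and
      \<open>b\<close>.\<close>
    define T where "T = root 4 (a * b ^ 3)"
    have T: "T > 0" "T ^ 4 = a * b ^ 3" using 3 by (simp_all add: T_def)
    have "ennreal (1/4) * (\<integral>\<^sup>+x. f x / a \<partial>lborel) + ennreal (3/4) * (\<integral>\<^sup>+x. g x / b \<partial>lborel)
        \<le> (\<integral>\<^sup>+x. h x / T \<partial>lborel)"
    proof (rule prekopa_leindler_sup_one)
      show "\<exists>x. s < f x / a" if "s < 1" for s
        using fa'[of "s * a"] that 3 by (auto simp: field_simps)
      show "\<exists>x. s < g x / b" if "s < 1" for s
        using gb'[of "s * b"] that 3 by (auto simp: field_simps)
      show "f x / a * (g y / b) ^ 3 \<le> (h ((x + 3 * y) / 4) / T) ^ 4" for x y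
      proof -
        have "f x / a * (g y / b) ^ 3 = f x * g y ^ 3 / T ^ 4" by (simp add: T power_divide)
        also have "\<dots> \<le> h ((x + 3 * y) / 4) ^ 4 / T ^ 4"
          using h(2) T(1) by (intro divide_right_mono) auto
        finally show ?thesis by (simp add: power_divide)
      qed
    qed (use f g h fa gb 3 T in auto)
    moreover have div: "(\<integral>\<^sup>+x. k x / c \<partial>lborel) = ennreal (1 / c) * (\<integral>\<^sup>+x. k x \<partial>lborel)"
      if [measurable]: "k \<in> borel_measurable borel" and "\<And>x. 0 \<le> k x" "c > 0" for k and c :: real
    proof -
      have "ennreal (k x / c) = ennreal (1 / c) * ennreal (k x)" for x
        using that(2)[of x] that(3) by (simp flip: ennreal_mult)
      then show ?thesis by (simp add: nn_integral_cmult)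
    qed
    ultimately have main: "ennreal (1/4) * (ennreal (1/a) * (\<integral>\<^sup>+x. f x \<partial>lborel))
        + ennreal (3/4) * (ennreal (1/b) * (\<integral>\<^sup>+x. g x \<partial>lborel)) \<le> ennreal (1/T) * (\<integral>\<^sup>+x. h x \<partial>lborel)"
      using f g h 3 T by (simp add: div)
    show ?thesis
    proof (cases "(\<integral>\<^sup>+x. h x \<partial>lborel) = \<infinity>")
      case True then show ?thesis by simp
    next
      case False
      then have fin: "ennreal (1/T) * (\<integral>\<^sup>+x. h x \<partial>lborel) \<noteq> \<infinity>"
        by (simp add: ennreal_mult_eq_top_iff)
      then have "(\<integral>\<^sup>+x. f x \<partial>lborel) \<noteq> \<infinity>" "(\<integral>\<^sup>+x. g x \<partial>lborel) \<noteq> \<infinity>"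
        using main 3 by (auto simp: ennreal_mult_eq_top_iff top_unique)
      then obtain p q r where pqr: "(\<integral>\<^sup>+x. f x \<partial>lborel) = ennreal p" "(\<integral>\<^sup>+x. g x \<partial>lborel) = ennreal q"
        "(\<integral>\<^sup>+x. h x \<partial>lborel) = ennreal r" "0 \<le> p" "0 \<le> q" "0 \<le> r"
        using False by (metis ennreal_cases infinity_ennreal_def)
      have "(p / a + 3 * (q / b)) / 4 \<le> r / T"
        using main 3 T pqr by (simp flip: ennreal_mult ennreal_plus add: field_simps)
      have "p * q ^ 3 = T ^ 4 * (p / a * (q / b) ^ 3)"
        using 3 by (simp add: T power_divide)
      also have "\<dots> \<le> T ^ 4 * ((p / a + 3 * (q / b)) / 4) ^ 4"
        using pqr 3 by (intro mult_left_mono weighted_am_gm_four) auto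
      also have "\<dots> \<le> T ^ 4 * (r / T) ^ 4"
        using pqr 3 T(1) \<open>(p / a + 3 * (q / b)) / 4 \<le> r / T\<close> by (intro mult_left_mono power_mono) auto
      also have "\<dots> = r ^ 4" using T(1) by (simp add: power_divide)
      finally show ?thesis using pqr by (simp add: ennreal_power ennreal_leI flip: ennreal_mult)
    qed
  qed
qed

text \<open>The densities are absorbed into the functions, with the density itself as
  \<open>h\<close>. The constant 3/8 is the convexity gain of the Gaussian exponent: x^2/4 + 3 y^2/4
  exceeds ((x + 3 y)/4)^2 by 3/16 (x - y)^2, and this is multiplied by 4 / (2 \<sigma>^2).\<close>

lemma prekopa_leindler_gaussian_real:
  fixes F G :: "real \<Rightarrow> ennreal"
  assumes [measurable]: "F \<in> borel_measurable borel" "G \<in> borel_measurable borel" and "\<sigma> > 0"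
    and FG: "\<And>x y. F x * G y ^ 3 \<le> ennreal (exp (3/8 * (x - y)\<^sup>2 / \<sigma>\<^sup>2))"
  defines "N \<equiv> density lborel (\<lambda>t. ennreal (normal_density 0 \<sigma> t))"
  shows "(\<integral>\<^sup>+x. F x \<partial>N) * (\<integral>\<^sup>+x. G x \<partial>N) ^ 3 \<le> 1"
proof -
  let ?\<phi> = "normal_density 0 \<sigma>"
  \<comment> \<open>Truncation at height \<open>k\<close> makes the functions finite and bounded;
    monotone convergence removes it.\<close>
  define cut where "cut = (\<lambda>(H :: real \<Rightarrow> ennreal) (k::nat) x. min (H x) (of_nat k))"
  have [measurable]: "cut H k \<in> borel_measurable borel" if [measurable]: "H \<in> borel_measurable borel" for H k
    unfolding cut_def by measurable
  have cut_fin: "ennreal (enn2real (cut H k x)) = cut H k x" for H k x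
  proof (rule ennreal_enn2real)
    have "cut H k x \<le> of_nat k" by (simp add: cut_def)
    also have "\<dots> < top" by (rule of_nat_less_top)
    finally show "cut H k x < top" .
  qed
  have cut_le: "enn2real (cut H k x) \<le> real k" for H k x
    by (rule enn2real_leI) (auto simp: cut_def ennreal_of_nat_eq_real_of_nat)
  have trunc: "(\<integral>\<^sup>+x. cut F k x \<partial>N) * (\<integral>\<^sup>+x. cut G k x \<partial>N) ^ 3 \<le> 1" for k
  proof -
    have int: "(\<integral>\<^sup>+x. cut H k x \<partial>N) = (\<integral>\<^sup>+x. enn2real (cut H k x) * ?\<phi> x \<partial>lborel)"
      if [measurable]: "H \<in> borel_measurable borel" for H
      unfolding N_def
      by (subst nn_integral_density) (auto simp: ennreal_mult cut_fin mult.commute)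
    have \<phi>: "?\<phi> x \<le> 1 / sqrt (2 * pi * \<sigma>\<^sup>2)" for x
      unfolding normal_density_def by (simp add: divide_right_mono)
    have bound: "enn2real (cut H k x) * ?\<phi> x \<le> real k * (1 / sqrt (2 * pi * \<sigma>\<^sup>2))" for H x
      using cut_le \<phi> by (intro mult_mono) auto
    have "(\<integral>\<^sup>+x. cut F k x \<partial>N) * (\<integral>\<^sup>+x. cut G k x \<partial>N) ^ 3 \<le> (\<integral>\<^sup>+x. ?\<phi> x \<partial>lborel) ^ 4"
      unfolding int[OF assms(1)] int[OF assms(2)]
    proof (rule prekopa_leindler_bounded[OF _ _ _ _ bound _ bound])
      fix x y :: real
      have "ennreal (enn2real (cut F k x) * enn2real (cut G k y) ^ 3) = cut F k x * cut G k y ^ 3"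
        by (simp add: ennreal_mult ennreal_power[symmetric] cut_fin)
      also have "\<dots> \<le> F x * G y ^ 3"
        by (intro mult_mono power_mono) (auto simp: cut_def)
      also have "\<dots> \<le> ennreal (exp (3/8 * (x - y)\<^sup>2 / \<sigma>\<^sup>2))" by (rule FG)
      finally have *: "enn2real (cut F k x) * enn2real (cut G k y) ^ 3 \<le> exp (3/8 * (x - y)\<^sup>2 / \<sigma>\<^sup>2)"
        by simp
      define c where "c = 1 / sqrt (2 * pi * \<sigma>\<^sup>2)"
      have "c \<ge> 0" by (simp add: c_def)
      have \<phi>c: "?\<phi> x = c * exp (- x\<^sup>2 / (2 * \<sigma>\<^sup>2))" for x
        by (simp add: normal_density_def c_def)
      have "enn2real (cut F k x) * ?\<phi> x * (enn2real (cut G k y) * ?\<phi> y) ^ 3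
          = (enn2real (cut F k x) * enn2real (cut G k y) ^ 3) * (?\<phi> x * ?\<phi> y ^ 3)"
        by (simp add: power_mult_distrib)
      also have "\<dots> \<le> exp (3/8 * (x - y)\<^sup>2 / \<sigma>\<^sup>2) * (?\<phi> x * ?\<phi> y ^ 3)"
        by (intro mult_right_mono *) auto
      also have "\<dots> = c ^ 4 * (exp (3/8 * (x - y)\<^sup>2 / \<sigma>\<^sup>2) * exp (- x\<^sup>2 / (2 * \<sigma>\<^sup>2)) * exp (- y\<^sup>2 / (2 * \<sigma>\<^sup>2)) ^ 3)"
        by (simp add: \<phi>c power_mult_distrib power_numeral_reduce)
      also have "exp (3/8 * (x - y)\<^sup>2 / \<sigma>\<^sup>2) * exp (- x\<^sup>2 / (2 * \<sigma>\<^sup>2)) * exp (- y\<^sup>2 / (2 * \<sigma>\<^sup>2)) ^ 3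
          = exp (3/8 * (x - y)\<^sup>2 / \<sigma>\<^sup>2 + - x\<^sup>2 / (2 * \<sigma>\<^sup>2) + 3 * (- y\<^sup>2 / (2 * \<sigma>\<^sup>2)))"
        by (simp only: exp_add exp_of_nat_mult[symmetric] of_nat_numeral)
      also have "3/8 * (x - y)\<^sup>2 / \<sigma>\<^sup>2 + - x\<^sup>2 / (2 * \<sigma>\<^sup>2) + 3 * (- y\<^sup>2 / (2 * \<sigma>\<^sup>2))
          = 4 * (- ((x + 3 * y) / 4)\<^sup>2 / (2 * \<sigma>\<^sup>2))"
        using \<open>\<sigma> > 0\<close> by (simp add: field_simps power2_eq_square)
      also have "exp \<dots> = exp (- ((x + 3 * y) / 4)\<^sup>2 / (2 * \<sigma>\<^sup>2)) ^ 4"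
        by (simp only: exp_of_nat_mult[symmetric] of_nat_numeral)
      finally show "enn2real (cut F k x) * ?\<phi> x * (enn2real (cut G k y) * ?\<phi> y) ^ 3
          \<le> ?\<phi> ((x + 3 * y) / 4) ^ 4"
        by (simp only: \<phi>c power_mult_distrib)
    qed auto
    also have "(\<integral>\<^sup>+x. ?\<phi> x \<partial>lborel) = 1"
      using prob_space.emeasure_space_1[OF prob_space_normal_density[OF \<open>\<sigma> > 0\<close>, of 0]]
      by (simp add: emeasure_density)
    finally show ?thesis by simp
  qed
  have lim: "(\<lambda>k. \<integral>\<^sup>+x. cut H k x \<partial>N) \<longlonglongrightarrow> (\<integral>\<^sup>+x. H x \<partial>N)" if [measurable]: "H \<in> borel_measurable borel" for H
  proof (rule nn_integral_LIMSEQ)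
    show "incseq (cut H)"
      by (auto simp: incseq_def cut_def le_fun_def intro: min.coboundedI2 of_nat_mono)
    show "(\<lambda>k. cut H k x) \<longlonglongrightarrow> H x" for x
    proof -
      have "(\<lambda>k. min (H x) (of_nat k)) \<longlonglongrightarrow> min (H x) top"
        by (intro tendsto_min tendsto_const of_nat_tendsto_top_ennreal)
      then show ?thesis by (simp add: cut_def)
    qed
    show "cut H k \<in> borel_measurable N" for k
      by (simp add: N_def)
  qed
  show ?thesis
  \<comment> \<open>Multiplication of extended nonnegative reals is discontinuous at zero times
    infinity, so the limit of the products is taken only when both integrals are nonzero. Otherwise
    the product is zero.\<close>
  proof (cases "(\<integral>\<^sup>+x. F x \<partial>N) = 0 \<or> (\<integral>\<^sup>+x. G x \<partial>N) = 0")
    case False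
    have "(\<lambda>k. (\<integral>\<^sup>+x. cut F k x \<partial>N) * ((\<integral>\<^sup>+x. cut G k x \<partial>N) * ((\<integral>\<^sup>+x. cut G k x \<partial>N) * (\<integral>\<^sup>+x. cut G k x \<partial>N))))
        \<longlonglongrightarrow> (\<integral>\<^sup>+x. F x \<partial>N) * ((\<integral>\<^sup>+x. G x \<partial>N) * ((\<integral>\<^sup>+x. G x \<partial>N) * (\<integral>\<^sup>+x. G x \<partial>N)))"
      using False by (intro tendsto_mult_ennreal lim) auto
    then show ?thesis
      using trunc by (intro LIMSEQ_le_const2[where X = "\<lambda>k. (\<integral>\<^sup>+x. cut F k x \<partial>N) * (\<integral>\<^sup>+x. cut G k x \<partial>N) ^ 3"])
        (auto simp: power3_eq_cube mult.assoc)
  qed auto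
qed

text \<open>Tensorisation: the quadratic cost is a sum over coordinates, so integrating out one
  coordinate yields functions that satisfy the same hypothesis on the remaining ones.\<close>

lemma prekopa_leindler_gaussian:
  fixes F G :: "('i \<Rightarrow> real) \<Rightarrow> ennreal"
  assumes "finite I" "\<sigma> > 0"
  defines "N \<equiv> density lborel (\<lambda>t. ennreal (normal_density 0 \<sigma> t))"
  assumes "F \<in> borel_measurable (\<Pi>\<^sub>M i\<in>I. N)" "G \<in> borel_measurable (\<Pi>\<^sub>M i\<in>I. N)"
    and "\<And>x y. x \<in> I \<rightarrow>\<^sub>E UNIV \<Longrightarrow> y \<in> I \<rightarrow>\<^sub>E UNIV \<Longrightarrow>
          F x * G y ^ 3 \<le> ennreal (exp (3/8 * (\<Sum>i\<in>I. (x i - y i)\<^sup>2) / \<sigma>\<^sup>2))"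
  shows "(\<integral>\<^sup>+x. F x \<partial>(\<Pi>\<^sub>M i\<in>I. N)) * (\<integral>\<^sup>+x. G x \<partial>(\<Pi>\<^sub>M i\<in>I. N)) ^ 3 \<le> 1"
proof -
  interpret N: prob_space N
    unfolding N_def by (rule prob_space_normal_density[OF \<open>\<sigma> > 0\<close>])
  interpret P: product_sigma_finite "\<lambda>_::'i. N"
    by standard
  have sets_N [measurable_cong]: "sets N = sets borel" by (simp add: N_def)
  have space_P: "space (\<Pi>\<^sub>M i\<in>J. N) = J \<rightarrow>\<^sub>E UNIV" for J :: "'i set"
    by (simp add: space_PiM N_def)
  show ?thesis
    using assms(1,4-)
  proof (induction I arbitrary: F G rule: finite_induct)
    case empty
    then show ?case
      using empty(3)[of "\<lambda>_. undefined" "\<lambda>_. undefined"]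
      by (simp add: PiM_empty nn_integral_count_space_finite)
  next
    case (insert i I)
    note [measurable] = insert.prems(1,2)
    define slice_int where "slice_int = (\<lambda>(H :: ('i \<Rightarrow> real) \<Rightarrow> ennreal) x. \<integral>\<^sup>+t. H (x(i := t)) \<partial>N)"
    have [measurable]: "(\<lambda>(x, t). H (x(i := t))) \<in> borel_measurable ((\<Pi>\<^sub>M i\<in>I. N) \<Otimes>\<^sub>M N)"
      if "H \<in> borel_measurable (\<Pi>\<^sub>M i\<in>insert i I. N)" for H :: "_ \<Rightarrow> ennreal"
      using measurable_compose[OF measurable_add_dim that] by (simp add: case_prod_beta')
    have [measurable]: "slice_int H \<in> borel_measurable (\<Pi>\<^sub>M i\<in>I. N)"
      if [measurable]: "H \<in> borel_measurable (\<Pi>\<^sub>M i\<in>insert i I. N)" for H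
      unfolding slice_int_def by measurable
    have eq: "(\<integral>\<^sup>+x. H x \<partial>(\<Pi>\<^sub>M i\<in>insert i I. N)) = (\<integral>\<^sup>+x. slice_int H x \<partial>(\<Pi>\<^sub>M i\<in>I. N))"
      if "H \<in> borel_measurable (\<Pi>\<^sub>M i\<in>insert i I. N)" for H
      unfolding slice_int_def using insert.hyps that by (intro P.product_nn_integral_insert)
    have "(\<integral>\<^sup>+x. slice_int F x \<partial>(\<Pi>\<^sub>M i\<in>I. N)) * (\<integral>\<^sup>+x. slice_int G x \<partial>(\<Pi>\<^sub>M i\<in>I. N)) ^ 3 \<le> 1"
    proof (rule insert.IH)
      fix x y :: "'i \<Rightarrow> real" assume x: "x \<in> I \<rightarrow>\<^sub>E UNIV" and y: "y \<in> I \<rightarrow>\<^sub>E UNIV"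
      define e where "e = exp (3/8 * (\<Sum>i\<in>I. (x i - y i)\<^sup>2) / \<sigma>\<^sup>2)"
      have "e > 0" by (simp add: e_def)
      have slice: "(\<lambda>t. H (z(i := t))) \<in> borel_measurable N"
        if [measurable]: "H \<in> borel_measurable (\<Pi>\<^sub>M i\<in>insert i I. N)" and "z \<in> I \<rightarrow>\<^sub>E UNIV" for H :: "_ \<Rightarrow> ennreal" and z
      proof -
        have "z \<in> space (\<Pi>\<^sub>M i\<in>I. N)" using that by (simp add: space_P)
        then show ?thesis by measurable
      qed
      have [measurable]: "(\<lambda>t. F (x(i := t))) \<in> borel_measurable borel" "(\<lambda>t. G (y(i := t))) \<in> borel_measurable borel"
        using slice[OF insert.prems(1) x] slice[OF insert.prems(2) y]
        unfolding measurable_cong_sets[OF sets_N refl] .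
      \<comment> \<open>Dividing by \<open>e\<close>, the cost of the other coordinates, leaves
        exactly the one-dimensional hypothesis in the new coordinate.\<close>
      have "(\<integral>\<^sup>+t. ennreal (1 / e) * F (x(i := t)) \<partial>N) * (\<integral>\<^sup>+t. G (y(i := t)) \<partial>N) ^ 3 \<le> 1"
        unfolding N_def
      proof (rule prekopa_leindler_gaussian_real)
        fix s t :: real
        have "(\<Sum>j\<in>insert i I. ((x(i := s)) j - (y(i := t)) j)\<^sup>2) = (s - t)\<^sup>2 + (\<Sum>j\<in>I. (x j - y j)\<^sup>2)"
        proof -
          have "(\<Sum>j\<in>I. ((x(i := s)) j - (y(i := t)) j)\<^sup>2) = (\<Sum>j\<in>I. (x j - y j)\<^sup>2)"
            using insert.hyps(2) by (intro sum.cong) auto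
          then show ?thesis using insert.hyps by simp
        qed
        then have "exp (3/8 * (\<Sum>j\<in>insert i I. ((x(i := s)) j - (y(i := t)) j)\<^sup>2) / \<sigma>\<^sup>2)
            = exp (3/8 * (s - t)\<^sup>2 / \<sigma>\<^sup>2) * e"
          by (simp add: e_def distrib_left add_divide_distrib exp_add)
        moreover have "F (x(i := s)) * G (y(i := t)) ^ 3
            \<le> ennreal (exp (3/8 * (\<Sum>j\<in>insert i I. ((x(i := s)) j - (y(i := t)) j)\<^sup>2) / \<sigma>\<^sup>2))"
          using x y by (intro insert.prems(3)) (auto simp: PiE_iff extensional_def split: if_splits)
        ultimately have "F (x(i := s)) * G (y(i := t)) ^ 3 \<le> ennreal (exp (3/8 * (s - t)\<^sup>2 / \<sigma>\<^sup>2) * e)"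
          by simp
        then have "ennreal (1 / e) * (F (x(i := s)) * G (y(i := t)) ^ 3)
            \<le> ennreal (1 / e) * ennreal (exp (3/8 * (s - t)\<^sup>2 / \<sigma>\<^sup>2) * e)"
          by (rule mult_left_mono) simp
        also have "\<dots> = ennreal (exp (3/8 * (s - t)\<^sup>2 / \<sigma>\<^sup>2))"
          using \<open>e > 0\<close> by (simp flip: ennreal_mult)
        finally show "ennreal (1 / e) * F (x(i := s)) * G (y(i := t)) ^ 3 \<le> ennreal (exp (3/8 * (s - t)\<^sup>2 / \<sigma>\<^sup>2))"
          by (simp add: mult.assoc)
      qed (use \<open>\<sigma> > 0\<close> in measurable)
      moreover have "(\<integral>\<^sup>+t. ennreal (1 / e) * F (x(i := t)) \<partial>N) = ennreal (1 / e) * slice_int F x"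
        unfolding slice_int_def using slice[OF insert.prems(1) x] by (rule nn_integral_cmult)
      ultimately have "ennreal (1 / e) * (slice_int F x * slice_int G y ^ 3) \<le> 1"
        by (simp add: slice_int_def mult.assoc)
      then have "ennreal e * (ennreal (1 / e) * (slice_int F x * slice_int G y ^ 3)) \<le> ennreal e * 1"
        by (rule mult_left_mono) simp
      then show "slice_int F x * slice_int G y ^ 3 \<le> ennreal (exp (3/8 * (\<Sum>i\<in>I. (x i - y i)\<^sup>2) / \<sigma>\<^sup>2))"
        unfolding e_def[symmetric] using \<open>e > 0\<close> by (simp add: mult.assoc[symmetric] ennreal_mult[symmetric])
    qed measurable
    then show ?case by (simp add: eq insert.prems)
  qed
qed

section \<open>Haar expansion of monotone vectors\<close>

text \<open>Dyadic intervals of fixed position are intersected with \<open>I\<close>, so the size of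
  \<open>I\<close> need not be a power of two; blocks at the border may be short or empty.\<close>

definition block :: "nat set \<Rightarrow> nat \<Rightarrow> nat \<Rightarrow> nat set" where
  "block I l j = {i \<in> I. i div 2 ^ l = j}"

definition block_coeff :: "nat set \<Rightarrow> nat \<Rightarrow> nat \<Rightarrow> (nat \<Rightarrow> real) \<Rightarrow> real" where
  "block_coeff I l j x = (\<Sum>i\<in>block I l j. x i) / sqrt (card (block I l j))"

text \<open>The inner product with the unit vector that is constant on each half of a block and
  orthogonal to constants. The square root normalises it for halves of unequal size; it vanishes if
  a half is empty.\<close>

definition haar_coeff :: "nat set \<Rightarrow> nat \<Rightarrow> nat \<Rightarrow> (nat \<Rightarrow> real) \<Rightarrow> real" where
  "haar_coeff I l j x =
     (let A = block I l (2 * j); B = block I l (2 * j + 1); a = real (card A); b = real (card B)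
      in sqrt (a * b / (a + b)) * ((\<Sum>i\<in>A. x i) / a - (\<Sum>i\<in>B. x i) / b))"

lemma finite_block [simp]: "finite I \<Longrightarrow> finite (block I l j)"
  by (simp add: block_def)

lemma block_Suc: "block I (Suc l) j = block I l (2 * j) \<union> block I l (2 * j + 1)"
proof -
  have "i div 2 ^ Suc l = j \<longleftrightarrow> i div 2 ^ l = 2 * j \<or> i div 2 ^ l = 2 * j + 1" for i
  proof -
    have "i div 2 ^ Suc l = i div 2 ^ l div 2"
      by (metis div_mult2_eq power_Suc2)
    moreover have "t div 2 = j \<longleftrightarrow> t = 2 * j \<or> t = 2 * j + 1" for t by presburger
    ultimately show ?thesis by simp
  qed
  then show ?thesis by (auto simp: block_def simp del: power_Suc)
qed

lemma block_disjoint: "j \<noteq> j' \<Longrightarrow> block I l j \<inter> block I l j' = {}"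
  by (auto simp: block_def)

lemma mem_block_bounds:
  assumes "i \<in> block I l j"
  shows "j * 2 ^ l \<le> i" "i < Suc j * 2 ^ l"
proof -
  have "j = i div 2 ^ l" using assms by (simp add: block_def)
  then show "j * 2 ^ l \<le> i" "i < Suc j * 2 ^ l"
    using dividend_less_div_times[of "2 ^ l" i] by simp_all
qed

lemma card_block_le: "card (block I l j) \<le> 2 ^ l"
proof -
  have "block I l j \<subseteq> {j * 2 ^ l..<j * 2 ^ l + 2 ^ l}"
    using mem_block_bounds by (fastforce simp: add.commute)
  from card_mono[OF _ this] show ?thesis by simp
qed

text \<open>In the plane spanned by the two half-block indicators, one orthonormal basis is
  exchanged for another, which preserves the inner product.\<close>

lemma haar_step:
  assumes "finite I"
  shows "block_coeff I l (2 * j) x * block_coeff I l (2 * j) y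
       + block_coeff I l (2 * j + 1) x * block_coeff I l (2 * j + 1) y
     = block_coeff I (Suc l) j x * block_coeff I (Suc l) j y + haar_coeff I l j x * haar_coeff I l j y"
proof -
  define A B where "A = block I l (2 * j)" and "B = block I l (2 * j + 1)"
  define a b where "a = real (card A)" and "b = real (card B)"
  have fin: "finite A" "finite B" using assms by (simp_all add: A_def B_def)
  have AB: "A \<inter> B = {}" unfolding A_def B_def by (intro block_disjoint) simp
  have Suc: "(\<Sum>i\<in>block I (Suc l) j. z i) = (\<Sum>i\<in>A. z i) + (\<Sum>i\<in>B. z i)" for z :: "nat \<Rightarrow> real"
    unfolding block_Suc using fin AB by (simp add: A_def B_def sum.union_disjoint)
  have card: "real (card (block I (Suc l) j)) = a + b"
    unfolding block_Suc using fin AB by (simp add: A_def B_def a_def b_def card_Un_disjoint)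
  have sq: "sqrt c * sqrt c = c" if "c \<ge> 0" for c :: real using that by simp
  have ab: "a \<ge> 0" "b \<ge> 0" by (simp_all add: a_def b_def)
  have zero: "a = 0 \<Longrightarrow> (\<Sum>i\<in>A. z i) = 0" "b = 0 \<Longrightarrow> (\<Sum>i\<in>B. z i) = 0" for z :: "nat \<Rightarrow> real"
    using fin by (auto simp: a_def b_def)
  define p q r s where "p = (\<Sum>i\<in>A. x i)" and "q = (\<Sum>i\<in>A. y i)"
    and "r = (\<Sum>i\<in>B. x i)" and "s = (\<Sum>i\<in>B. y i)"
  have "p * q / a + r * s / b = (p + r) * (q + s) / (a + b) + a * b / (a + b) * ((p / a - r / b) * (q / a - s / b))"
  \<comment> \<open>An empty half has zero sums, and division by zero gives zero, so the identity
    survives in the degenerate cases.\<close>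
  proof (cases "a = 0 \<or> b = 0")
    case True
    then show ?thesis using zero[of x] zero[of y] by (auto simp: p_def q_def r_def s_def)
  next
    case False
    then have "a > 0" "b > 0" using ab by auto
    then have nz: "a \<noteq> 0" "b \<noteq> 0" "a + b \<noteq> 0" by auto
    then show ?thesis by (simp add: divide_simps) algebra
  qed
  moreover have "block_coeff I l (2 * j) x * block_coeff I l (2 * j) y = p * q / a"
    by (simp add: block_coeff_def A_def[symmetric] a_def[symmetric] p_def q_def ab)
  moreover have "block_coeff I l (2 * j + 1) x * block_coeff I l (2 * j + 1) y = r * s / b"
    unfolding block_coeff_def B_def[symmetric] b_def[symmetric] r_def s_def by (simp add: ab)
  moreover have "block_coeff I (Suc l) j x * block_coeff I (Suc l) j y = (p + r) * (q + s) / (a + b)"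
    unfolding block_coeff_def Suc card p_def q_def r_def s_def using ab by simp
  moreover have "haar_coeff I l j x * haar_coeff I l j y
      = a * b / (a + b) * ((p / a - r / b) * (q / a - s / b))"
  proof -
    have "haar_coeff I l j z = sqrt (a * b / (a + b)) * ((\<Sum>i\<in>A. z i) / a - (\<Sum>i\<in>B. z i) / b)" for z
      by (simp add: haar_coeff_def Let_def A_def B_def a_def b_def)
    moreover have "sqrt (a * b / (a + b)) * sqrt (a * b / (a + b)) = a * b / (a + b)"
      using ab by (intro sq) simp
    ultimately show ?thesis unfolding p_def q_def r_def s_def by (metis (no_types, lifting) mult.assoc mult.left_commute)
  qed
  ultimately show ?thesis by simp
qed

lemma sum_lessThan_double:
  fixes f :: "nat \<Rightarrow> 'a::comm_monoid_add"
  shows "(\<Sum>j<2 * q. f j) = (\<Sum>j<q. f (2 * j) + f (2 * j + 1))"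
  by (induction q) (simp_all add: ac_simps)

lemma haar_expansion:
  assumes "finite I" "I \<subseteq> {..<2 ^ P}" "L \<le> P"
  shows "(\<Sum>i\<in>I. x i * y i) = (\<Sum>j<2 ^ (P - L). block_coeff I L j x * block_coeff I L j y)
      + (\<Sum>l<L. \<Sum>j<2 ^ (P - Suc l). haar_coeff I l j x * haar_coeff I l j y)"
  using \<open>L \<le> P\<close>
proof (induction L)
  case 0
  have "block I 0 j = (if j \<in> I then {j} else {})" for j by (auto simp: block_def)
  then have "block_coeff I 0 j x * block_coeff I 0 j y = (if j \<in> I then x j * y j else 0)" for j
    by (simp add: block_coeff_def)
  then show ?case using assms by (simp add: sum.If_cases Int_absorb1)
next
  case (Suc L)
  then have "(2::nat) ^ (P - L) = 2 * 2 ^ (P - Suc L)"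
    by (metis Suc_diff_Suc Suc_le_eq power_Suc)
  then have "(\<Sum>j<2 ^ (P - L). block_coeff I L j x * block_coeff I L j y)
      = (\<Sum>j<2 ^ (P - Suc L). block_coeff I (Suc L) j x * block_coeff I (Suc L) j y)
        + (\<Sum>j<2 ^ (P - Suc L). haar_coeff I L j x * haar_coeff I L j y)"
    by (simp only: sum_lessThan_double haar_step[OF \<open>finite I\<close>] sum.distrib)
  then show ?case using Suc by simp
qed

lemma sum_le_mean:
  fixes f :: "'a \<Rightarrow> real"
  assumes "finite A" "A \<noteq> {}" "\<And>i. i \<in> A \<Longrightarrow> lo \<le> f i" "\<And>i. i \<in> A \<Longrightarrow> f i \<le> hi"
  shows "lo \<le> sum f A / card A" "sum f A / card A \<le> hi"
proof -
  have "card A > 0" using assms by (simp add: card_gt_0_iff)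
  then show "lo \<le> sum f A / card A" "sum f A / card A \<le> hi"
    using sum_bounded_below[of A lo f] sum_bounded_above[of A f hi] assms
    by (auto simp: field_simps)
qed

lemma haar_coeff_diff: "haar_coeff I l j (\<lambda>i. x i - y i) = haar_coeff I l j x - haar_coeff I l j y"
  by (simp add: haar_coeff_def Let_def sum_subtractf algebra_simps diff_divide_distrib)

text \<open>By monotonicity the means over the two halves differ by at most the increase of
  \<open>f\<close> across the block, and these increases telescope. The normalising factor is at
  most \<open>sqrt (2 ^ l)\<close>.\<close>

lemma sum_abs_haar_coeff_mono:
  fixes f :: "nat \<Rightarrow> real"
  assumes "p \<le> q" and mono: "\<And>i j. p \<le> i \<Longrightarrow> i \<le> j \<Longrightarrow> j \<le> q \<Longrightarrow> f i \<le> f j"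
  shows "(\<Sum>j<K. \<bar>haar_coeff {p..q} l j f\<bar>) \<le> sqrt (2 ^ l) * (f q - f p)"
proof -
  \<comment> \<open>Constant extension beyond \<open>p\<close> and \<open>q\<close>, because the
    dyadic grid points of the telescoping sum may fall outside the range.\<close>
  define F where "F = (\<lambda>i. f (max p (min i q)))"
  have F_mono: "F i \<le> F j" if "i \<le> j" for i j
    unfolding F_def using that \<open>p \<le> q\<close> by (intro mono) auto
  have F_eq: "F i = f i" if "i \<in> {p..q}" for i
    using that by (simp add: F_def)
  have bound: "\<bar>haar_coeff {p..q} l j f\<bar> \<le> sqrt (2 ^ l) * (F (Suc j * 2 ^ Suc l) - F (j * 2 ^ Suc l))" for j
  proof -
    define A B where "A = block {p..q} l (2 * j)" and "B = block {p..q} l (2 * j + 1)"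
    define a b where "a = real (card A)" and "b = real (card B)"
    define lo hi where "lo = F (j * 2 ^ Suc l)" and "hi = F (Suc j * 2 ^ Suc l)"
    have fin: "finite A" "finite B" by (simp_all add: A_def B_def)
    have "lo \<le> hi" unfolding lo_def hi_def by (intro F_mono) simp
    have haar: "haar_coeff {p..q} l j f = sqrt (a * b / (a + b)) * (sum f A / a - sum f B / b)"
      by (simp add: haar_coeff_def Let_def A_def B_def a_def b_def)
    have in_block: "lo \<le> f i \<and> f i \<le> hi" if "i \<in> A \<union> B" for i
    proof -
      have "i \<in> block {p..q} (Suc l) j" using that by (simp add: A_def B_def block_Suc)
      then have i: "i \<in> {p..q}" "j * 2 ^ Suc l \<le> i" "i \<le> Suc j * 2 ^ Suc l"
        using mem_block_bounds[of i "{p..q}" "Suc l" j] by (auto simp: block_def simp del: power_Suc mult_Suc)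
      then show ?thesis
        unfolding lo_def hi_def F_eq[OF i(1), symmetric] by (intro conjI F_mono)
    qed
    show ?thesis
    proof (cases "A = {} \<or> B = {}")
      case True
      then have "haar_coeff {p..q} l j f = 0" by (auto simp: haar a_def b_def)
      then show ?thesis using \<open>lo \<le> hi\<close> by (simp add: lo_def hi_def)
    next
      case False
      then have pos: "a > 0" "b > 0" using fin by (auto simp: a_def b_def card_gt_0_iff)
      have "\<bar>sum f A / a - sum f B / b\<bar> \<le> hi - lo"
        using sum_le_mean[of A lo f hi] sum_le_mean[of B lo f hi] fin False in_block
        unfolding a_def b_def by (auto simp: abs_le_iff)
      moreover have "a * b / (a + b) \<le> a" using pos by (simp add: field_simps)
      moreover have "a \<le> real (2 ^ l)"
        unfolding a_def A_def of_nat_le_iff by (rule card_block_le)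
      ultimately have "sqrt (a * b / (a + b)) * \<bar>sum f A / a - sum f B / b\<bar> \<le> sqrt (2 ^ l) * (hi - lo)"
        by (intro mult_mono real_sqrt_le_mono) simp_all
      moreover have "\<bar>haar_coeff {p..q} l j f\<bar> = sqrt (a * b / (a + b)) * \<bar>sum f A / a - sum f B / b\<bar>"
        using pos by (simp add: haar abs_mult)
      ultimately show ?thesis by (simp add: lo_def hi_def)
    qed
  qed
  have "(\<Sum>j<K. \<bar>haar_coeff {p..q} l j f\<bar>) \<le> (\<Sum>j<K. sqrt (2 ^ l) * (F (Suc j * 2 ^ Suc l) - F (j * 2 ^ Suc l)))"
    by (intro sum_mono bound)
  also have "\<dots> = sqrt (2 ^ l) * (F (K * 2 ^ Suc l) - F 0)"
    using sum_lessThan_telescope[of "\<lambda>j. F (j * 2 ^ Suc l)" K]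
    by (simp add: sum_distrib_left[symmetric] del: power_Suc mult_Suc)
  also have "\<dots> \<le> sqrt (2 ^ l) * (f q - f p)"
  proof (intro mult_left_mono diff_mono)
    show "F (K * 2 ^ Suc l) \<le> f q" unfolding F_def using \<open>p \<le> q\<close> by (intro mono) auto
    show "f p \<le> F 0" using \<open>p \<le> q\<close> by (simp add: F_def)
  qed auto
  finally show ?thesis .
qed

section \<open>Soft thresholding of a single coefficient\<close>

text \<open>A majorant of the exponential of the absolute value that is a sum of two exponentials of
  linear forms, so that its Gaussian mean is explicit.\<close>

definition cosh2 :: "real \<Rightarrow> real" where
  "cosh2 t = exp t + exp (- t)"

text \<open>Noise up to the level \<tau> is charged to the size of \<open>h\<close>. The excess s
  over \<tau> is absorbed by half of the square of \<open>h\<close> at a price 2 s^2, and this is at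
  most 4 exp s. The other half of the square remains free.\<close>

lemma soft_threshold_bound:
  fixes N h \<tau> :: real
  assumes "0 \<le> \<tau>"
  shows "2 * (N * h) - h * h / 2 \<le> 2 * \<tau> * \<bar>h\<bar> + 4 * exp (- \<tau>) * cosh2 N"
proof -
  define s where "s = \<bar>N\<bar> - \<tau>"
  have "N * h \<le> \<bar>N\<bar> * \<bar>h\<bar>" by (metis abs_ge_self abs_mult)
  also have "\<dots> = \<tau> * \<bar>h\<bar> + s * \<bar>h\<bar>" by (simp add: s_def algebra_simps)
  finally have 1: "2 * (N * h) \<le> 2 * \<tau> * \<bar>h\<bar> + 2 * (s * \<bar>h\<bar>)" by simp
  have "2 * (s * \<bar>h\<bar>) - h * h / 2 \<le> 4 * exp s"
  proof (cases "s \<le> 0")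
    case True
    then have "s * \<bar>h\<bar> \<le> 0" by (simp add: mult_nonpos_nonneg)
    moreover have "h * h \<ge> 0" "4 * exp s > 0" by simp_all
    ultimately show ?thesis by linarith
  next
    case False
    have "(2 * s - \<bar>h\<bar>)\<^sup>2 \<ge> 0" by simp
    then have "2 * (s * \<bar>h\<bar>) - h * h / 2 \<le> 2 * s\<^sup>2"
      by (simp add: power2_eq_square algebra_simps)
    moreover have "1 + s + s\<^sup>2 / 2 \<le> exp s" using False by (intro exp_lower_Taylor_quadratic) simp
    then have "2 * s\<^sup>2 \<le> 4 * exp s" using False by simp
    ultimately show ?thesis by linarith
  qed
  also have "exp s = exp (- \<tau>) * exp \<bar>N\<bar>" by (simp add: s_def exp_diff exp_minus field_simps)
  also have "4 * (exp (- \<tau>) * exp \<bar>N\<bar>) \<le> 4 * (exp (- \<tau>) * cosh2 N)"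
    by (intro mult_left_mono) (auto simp: cosh2_def abs_if)
  finally show ?thesis using 1 unfolding mult.assoc by linarith
qed


text \<open>The middle of the index range is expanded in an adapted Haar basis; the \<open>k\<close> outermost
  indices on either side are treated one by one, which confines the middle part of \<open>v\<close> to a
  window only slightly wider than the range of \<open>u\<close>.\<close>

lemma isotonic_noise_bound:
  fixes g u v :: "nat \<Rightarrow> real" and n k L P :: nat
  assumes "1 \<le> k" "2 * k < n" "n < 2 ^ P" "L \<le> P"
    and u: "\<And>i j. 1 \<le> i \<Longrightarrow> i \<le> j \<Longrightarrow> j \<le> n \<Longrightarrow> u i \<le> u j"
    and v: "\<And>i j. 1 \<le> i \<Longrightarrow> i \<le> j \<Longrightarrow> j \<le> n \<Longrightarrow> v i \<le> v j"
  defines "I \<equiv> {k + 1..n - k}"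
    and "S \<equiv> (\<Sum>l<L. 2 * real (L - l) * sqrt (2 ^ l))"
  shows "2 * (\<Sum>i=1..n. g i * (v i - u i)) - (\<Sum>i=1..n. (v i - u i)\<^sup>2)
    \<le> 2 * S * (u n - u 1) + 2 * S\<^sup>2 / k
      + 4 * (\<Sum>i\<in>{1..n} - I. cosh2 (g i))
      + 4 * (\<Sum>j<2 ^ (P - L). cosh2 (block_coeff I L j g))
      + (\<Sum>l<L. 4 * exp (- real (L - l)) * (\<Sum>j<2 ^ (P - Suc l). cosh2 (haar_coeff I l j g)))"
proof -
  define \<theta> where "\<theta> = (\<lambda>i. v i - u i)"
  define D where "D = (\<Sum>i=1..n. (\<theta> i)\<^sup>2)"
  \<comment> \<open>The largest common lower bound that \<open>k\<close> coordinates of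
    \<open>\<theta>\<close> can have in absolute value when the total square is
    \<open>D\<close>.\<close>
  define \<omega> where "\<omega> = sqrt (D / k)"
  define Q where "Q = (\<lambda>N h :: real. 2 * (N * h) - h * h / 2)"
  have "D \<ge> 0" by (simp add: D_def sum_nonneg)
  have "k > 0" using \<open>1 \<le> k\<close> by simp
  have I: "finite I" "I \<subseteq> {1..n}" "I \<subseteq> {..<2 ^ P}"
    using assms(3) by (auto simp: I_def)
  have tail: "t \<le> \<omega>" if "J \<subseteq> {1..n}" "card J = k" "\<And>j. j \<in> J \<Longrightarrow> t \<le> \<bar>\<theta> j\<bar>" for t J
  proof (cases "t \<le> 0")
    case True
    moreover have "\<omega> \<ge> 0" using \<open>D \<ge> 0\<close> by (simp add: \<omega>_def)
    ultimately show ?thesis by simp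
  next
    case False
    have "k * t\<^sup>2 = (\<Sum>j\<in>J. t\<^sup>2)" using that(2) by simp
    also have "\<dots> \<le> (\<Sum>j\<in>J. (\<theta> j)\<^sup>2)"
      using that(3) False by (intro sum_mono) (simp add: abs_le_square_iff[symmetric])
    also have "\<dots> \<le> D" unfolding D_def using that(1) by (intro sum_mono2) auto
    finally have "t\<^sup>2 \<le> D / k" using \<open>k > 0\<close> by (simp add: field_simps)
    then show ?thesis unfolding \<omega>_def by (rule real_le_rsqrt)
  qed
  \<comment> \<open>On each of the last \<open>k\<close> indices, \<open>v\<close> is at least
    \<open>v (n - k)\<close> while \<open>u\<close> is at most \<open>u n\<close>, so an overshoot
    is repeated \<open>k\<close> times.\<close>
  have hi: "v (n - k) - u n \<le> \<omega>"
  proof (rule tail[of "{n - k + 1..n}"])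
    fix j assume "j \<in> {n - k + 1..n}"
    moreover have "1 \<le> n - k" using assms(2) by simp
    ultimately show "v (n - k) - u n \<le> \<bar>\<theta> j\<bar>"
      using v[of "n - k" j] u[of j n] by (auto simp: \<theta>_def)
  qed (use assms(2) in auto)
  have lo: "u 1 - v (k + 1) \<le> \<omega>"
  proof (rule tail[of "{1..k}"])
    fix j assume "j \<in> {1..k}"
    then show "u 1 - v (k + 1) \<le> \<bar>\<theta> j\<bar>"
      using v[of j "k + 1"] u[of 1 j] assms(2) by (auto simp: \<theta>_def)
  qed (use assms(2) in auto)
  have haar_sum: "(\<Sum>j<K. \<bar>haar_coeff I l j \<theta>\<bar>) \<le> sqrt (2 ^ l) * (2 * (u n - u 1) + 2 * \<omega>)" for l K
  proof -
    have "(\<Sum>j<K. \<bar>haar_coeff I l j \<theta>\<bar>) \<le> (\<Sum>j<K. \<bar>haar_coeff I l j v\<bar> + \<bar>haar_coeff I l j u\<bar>)"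
      unfolding \<theta>_def haar_coeff_diff by (intro sum_mono) linarith
    also have "\<dots> \<le> sqrt (2 ^ l) * (v (n - k) - v (k + 1)) + sqrt (2 ^ l) * (u (n - k) - u (k + 1))"
      unfolding sum.distrib I_def using assms(2) u v
      by (intro add_mono sum_abs_haar_coeff_mono) auto
    also have "\<dots> = sqrt (2 ^ l) * ((v (n - k) - v (k + 1)) + (u (n - k) - u (k + 1)))"
      by (simp add: distrib_left)
    also have "\<dots> \<le> sqrt (2 ^ l) * (2 * (u n - u 1) + 2 * \<omega>)"
    proof (rule mult_left_mono)
      have "1 \<le> n - k" using assms(2) by simp
      then show "(v (n - k) - v (k + 1)) + (u (n - k) - u (k + 1)) \<le> 2 * (u n - u 1) + 2 * \<omega>"
        using hi lo u[of "n - k" n] u[of 1 "k + 1"] assms(2) by auto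
    qed simp
    finally show ?thesis .
  qed
  \<comment> \<open>\<open>Q\<close> is a bilinear term minus a quadratic one, so the orthonormal
    change of basis carries over to it.\<close>
  have expand: "(\<Sum>i\<in>I. Q (g i) (\<theta> i)) = (\<Sum>j<2 ^ (P - L). Q (block_coeff I L j g) (block_coeff I L j \<theta>))
      + (\<Sum>l<L. \<Sum>j<2 ^ (P - Suc l). Q (haar_coeff I l j g) (haar_coeff I l j \<theta>))"
    unfolding Q_def sum_subtractf sum_distrib_left[symmetric] sum_divide_distrib[symmetric]
      haar_expansion[OF I(1,3) assms(4)] by (simp add: field_simps)
  \<comment> \<open>Threshold zero, at a price of constant mean per term; affordable only for the
    coarse blocks and the outer indices, which are few.\<close>
  have Q0: "Q N h \<le> 4 * cosh2 N" for N h
    using soft_threshold_bound[of 0 N h] by (simp add: Q_def)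
  have level: "(\<Sum>j<2 ^ (P - Suc l). Q (haar_coeff I l j g) (haar_coeff I l j \<theta>))
      \<le> 2 * real (L - l) * sqrt (2 ^ l) * (2 * (u n - u 1) + 2 * \<omega>)
        + 4 * exp (- real (L - l)) * (\<Sum>j<2 ^ (P - Suc l). cosh2 (haar_coeff I l j g))" for l
  proof -
    have "(\<Sum>j<2 ^ (P - Suc l). Q (haar_coeff I l j g) (haar_coeff I l j \<theta>))
        \<le> (\<Sum>j<2 ^ (P - Suc l). 2 * real (L - l) * \<bar>haar_coeff I l j \<theta>\<bar>
              + 4 * exp (- real (L - l)) * cosh2 (haar_coeff I l j g))"
      \<comment> \<open>The threshold is the depth \<open>L - l\<close>: the factor
        \<open>exp (- real (L - l))\<close> outweighs the doubling of the number of coefficients per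
        level.\<close>
      unfolding Q_def by (intro sum_mono soft_threshold_bound) simp
    also have "\<dots> = 2 * real (L - l) * (\<Sum>j<2 ^ (P - Suc l). \<bar>haar_coeff I l j \<theta>\<bar>)
        + 4 * exp (- real (L - l)) * (\<Sum>j<2 ^ (P - Suc l). cosh2 (haar_coeff I l j g))"
      by (simp add: sum.distrib sum_distrib_left)
    also have "2 * real (L - l) * (\<Sum>j<2 ^ (P - Suc l). \<bar>haar_coeff I l j \<theta>\<bar>)
        \<le> 2 * real (L - l) * (sqrt (2 ^ l) * (2 * (u n - u 1) + 2 * \<omega>))"
      by (intro mult_left_mono haar_sum) simp
    finally show ?thesis by (simp add: mult.assoc)
  qed
  have middle: "(\<Sum>i\<in>I. Q (g i) (\<theta> i)) \<le> 4 * (\<Sum>j<2 ^ (P - L). cosh2 (block_coeff I L j g))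
      + (S * (2 * (u n - u 1) + 2 * \<omega>)
        + (\<Sum>l<L. 4 * exp (- real (L - l)) * (\<Sum>j<2 ^ (P - Suc l). cosh2 (haar_coeff I l j g))))"
    unfolding expand S_def sum_distrib_right sum.distrib[symmetric] sum_distrib_left[of 4 _ "{..<2 ^ (P - L)}"]
    by (intro add_mono sum_mono Q0 level)
  have ends: "(\<Sum>i\<in>{1..n} - I. Q (g i) (\<theta> i)) \<le> 4 * (\<Sum>i\<in>{1..n} - I. cosh2 (g i))"
    unfolding sum_distrib_left by (intro sum_mono Q0)
  have total: "2 * (\<Sum>i=1..n. g i * \<theta> i) - D = (\<Sum>i=1..n. Q (g i) (\<theta> i)) - D / 2"
    by (simp add: Q_def sum_subtractf sum_distrib_left D_def power2_eq_square sum_negf flip: sum_divide_distrib)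
  have split: "(\<Sum>i=1..n. Q (g i) (\<theta> i)) = (\<Sum>i\<in>{1..n} - I. Q (g i) (\<theta> i)) + (\<Sum>i\<in>I. Q (g i) (\<theta> i))"
    using I by (intro sum.subset_diff) auto
  \<comment> \<open>The reserved half of the penalty pays for the overshoot, by completing the
    square in \<omega>.\<close>
  have "2 * S * \<omega> - D / 2 \<le> 2 * S\<^sup>2 / k"
  proof -
    have D: "D = k * \<omega>\<^sup>2" using \<open>D \<ge> 0\<close> \<open>k > 0\<close> by (simp add: \<omega>_def)
    have "0 \<le> (k * \<omega> - 2 * S)\<^sup>2 / (2 * k)" by simp
    also have "\<dots> = 2 * S\<^sup>2 / k - (2 * S * \<omega> - D / 2)"
      unfolding D using \<open>k > 0\<close> by (simp add: field_simps power2_eq_square)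
    finally show ?thesis by simp
  qed
  then have "S * (2 * (u n - u 1) + 2 * \<omega>) - D / 2 \<le> 2 * S * (u n - u 1) + 2 * S\<^sup>2 / k"
    by (simp add: algebra_simps)
  then have "2 * (\<Sum>i=1..n. g i * \<theta> i) - D
    \<le> 2 * S * (u n - u 1) + 2 * S\<^sup>2 / k
      + 4 * (\<Sum>i\<in>{1..n} - I. cosh2 (g i))
      + 4 * (\<Sum>j<2 ^ (P - L). cosh2 (block_coeff I L j g))
      + (\<Sum>l<L. 4 * exp (- real (L - l)) * (\<Sum>j<2 ^ (P - Suc l). cosh2 (haar_coeff I l j g)))"
    using total split middle ends by argo
  then show ?thesis by (simp only: \<theta>_def D_def)
qed

section \<open>Coefficients as linear forms of norm at most one\<close>

text \<open>Bounds the variance of the coefficient under Gaussian noise on the larger index set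
  \<open>J\<close>. The norm is 1 for nonempty halves and 0 in the degenerate case, hence an
  inequality.\<close>

lemma haar_coeff_linear_form:
  assumes "finite J" "I \<subseteq> J"
  shows "\<exists>w. (\<forall>x. haar_coeff I l j x = (\<Sum>i\<in>J. w i * x i)) \<and> (\<Sum>i\<in>J. (w i)\<^sup>2) \<le> 1"
proof -
  define A B where "A = block I l (2 * j)" and "B = block I l (2 * j + 1)"
  define a b where "a = real (card A)" and "b = real (card B)"
  define s where "s = sqrt (a * b / (a + b))"
  define w where "w = (\<lambda>i. s * (indicator A i / a - indicator B i / b))"
  have sub: "A \<subseteq> J" "B \<subseteq> J" using assms by (auto simp: A_def B_def block_def)
  have AB: "A \<inter> B = {}" unfolding A_def B_def by (intro block_disjoint) simp
  have ab: "a \<ge> 0" "b \<ge> 0" by (simp_all add: a_def b_def)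
  have ind: "(\<Sum>i\<in>J. indicator C i * f i) = sum f C" if "C \<subseteq> J" for C and f :: "nat \<Rightarrow> real"
    using that \<open>finite J\<close> by (intro sum.mono_neutral_cong_right) auto
  have "haar_coeff I l j x = (\<Sum>i\<in>J. w i * x i)" for x
  proof -
    have "(\<Sum>i\<in>J. w i * x i) = (\<Sum>i\<in>J. s / a * (indicator A i * x i) - s / b * (indicator B i * x i))"
      by (intro sum.cong) (auto simp: w_def field_simps)
    also have "\<dots> = s / a * sum x A - s / b * sum x B"
      by (simp only: sum_subtractf sum_distrib_left[symmetric] ind[OF sub(1)] ind[OF sub(2)])
    finally show ?thesis
      by (simp add: haar_coeff_def Let_def A_def B_def a_def b_def s_def right_diff_distrib)
  qed
  moreover have "(\<Sum>i\<in>J. (w i)\<^sup>2) \<le> 1"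
  proof -
    have "(\<Sum>i\<in>J. (w i)\<^sup>2) = (\<Sum>i\<in>J. (s / a)\<^sup>2 * (indicator A i * 1) + (s / b)\<^sup>2 * (indicator B i * 1))"
    proof (intro sum.cong refl)
      fix i
      have "i \<notin> A \<or> i \<notin> B" using AB by blast
      then show "(w i)\<^sup>2 = (s / a)\<^sup>2 * (indicator A i * 1) + (s / b)\<^sup>2 * (indicator B i * 1)"
        by (auto simp: w_def indicator_def power2_eq_square)
    qed
    also have "\<dots> = (s / a)\<^sup>2 * a + (s / b)\<^sup>2 * b"
      unfolding sum.distrib sum_distrib_left[symmetric] ind[OF sub(1)] ind[OF sub(2)]
      by (simp add: a_def b_def)
    also have "\<dots> = a * b / (a + b) * (a / a\<^sup>2 + b / b\<^sup>2)"
      using ab by (simp add: s_def power_divide distrib_left)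
    also have "\<dots> \<le> 1"
    proof (cases "a = 0 \<or> b = 0")
      case False
      then have "a > 0" "b > 0" using ab by auto
      then have "a * b / (a + b) * (a / a\<^sup>2 + b / b\<^sup>2) = 1"
        by (simp add: divide_simps power2_eq_square)
      then show ?thesis by simp
    qed auto
    finally show ?thesis .
  qed
  ultimately show ?thesis by blast
qed

lemma block_coeff_linear_form:
  assumes "finite J" "I \<subseteq> J"
  shows "\<exists>w. (\<forall>x. block_coeff I l j x = (\<Sum>i\<in>J. w i * x i)) \<and> (\<Sum>i\<in>J. (w i)\<^sup>2) \<le> 1"
proof -
  define A where "A = block I l j"
  define w where "w = (\<lambda>i. indicator A i / sqrt (card A))"
  have sub: "A \<subseteq> J" using assms by (auto simp: A_def block_def)
  have ind: "(\<Sum>i\<in>J. indicator A i * f i) = sum f A" for f :: "nat \<Rightarrow> real"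
    using sub \<open>finite J\<close> by (intro sum.mono_neutral_cong_right) auto
  have "block_coeff I l j x = (\<Sum>i\<in>J. w i * x i)" for x
    by (simp add: block_coeff_def w_def A_def[symmetric] ind flip: sum_divide_distrib)
  moreover have "(\<Sum>i\<in>J. (w i)\<^sup>2) = (\<Sum>i\<in>J. indicator A i * (1 / real (card A)))"
    by (intro sum.cong) (auto simp: w_def indicator_def power_divide)
  then have "(\<Sum>i\<in>J. (w i)\<^sup>2) \<le> 1"
    unfolding ind by simp
  ultimately show ?thesis by blast
qed

section \<open>Projection onto the monotone cone\<close>

lemma scaled_norm_vdiff_sq: "(scaled_norm n (vdiff n v w))\<^sup>2 = (\<Sum>i=1..n. (v i - w i)\<^sup>2) / n"
  by (simp add: scaled_norm_def vdiff_def sum_nonneg)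

lemma S_up_mono:
  assumes "u \<in> S_up n" "1 \<le> i" "i \<le> j" "j \<le> n"
  shows "u i \<le> u j"
  using assms(3,4)
proof (induction j rule: dec_induct)
  case (step j)
  then have "u j \<le> u (j + 1)" using assms(1,2) by (auto simp: S_up_def)
  then show ?case using step by simp
qed simp

lemma V_S_up:
  assumes "u \<in> S_up n" "1 \<le> n"
  shows "V n u = u n - u 1"
proof -
  have "Max (u ` {1..n}) = u n"
    using assms S_up_mono[OF assms(1)] by (intro Max_eqI) auto
  moreover have "Min (u ` {1..n}) = u 1"
    using assms S_up_mono[OF assms(1)] by (intro Min_eqI) auto
  ultimately show ?thesis by (simp add: V_def)
qed

lemma S_up_convex_comb:
  assumes "u \<in> S_up n" "v \<in> S_up n" "0 \<le> t" "t \<le> 1"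
  shows "(\<lambda>i\<in>{1..n}. u i + t * (v i - u i)) \<in> S_up n"
proof -
  have "u i + t * (v i - u i) \<le> u (i + 1) + t * (v (i + 1) - u (i + 1))" if "i \<in> {1..<n}" for i
  proof -
    have "u i \<le> u (i + 1)" "v i \<le> v (i + 1)" using assms(1,2) that by (auto simp: S_up_def)
    then have "(1 - t) * u i + t * v i \<le> (1 - t) * u (i + 1) + t * v (i + 1)"
      using assms(3,4) by (intro add_mono mult_left_mono) auto
    then show ?thesis by (simp add: algebra_simps)
  qed
  then show ?thesis by (auto simp: S_up_def Rn_def)
qed

text \<open>Serves both the estimator and the oracle, whose minimisers are chosen by
  \<open>arg_min_on\<close> and hence meaningful only once existence is known. \<open>F\<close> is a
  globally continuous formula for \<open>f\<close> on the cone. By coercivity the minimum over a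
  compact box is global.\<close>

lemma arg_min_on_S_up:
  fixes f F :: "(nat \<Rightarrow> real) \<Rightarrow> real"
  assumes "1 \<le> n" and F: "continuous_on UNIV F" "\<And>v. v \<in> S_up n \<Longrightarrow> f v = F v"
    and coercive: "\<And>v. v \<in> S_up n \<Longrightarrow> (\<Sum>i=1..n. (v i - z i)\<^sup>2) / n \<le> f v"
  shows "arg_min_on f (S_up n) \<in> S_up n" "v \<in> S_up n \<Longrightarrow> f (arg_min_on f (S_up n)) \<le> f v"
proof -
  define v0 where "v0 = (\<lambda>i\<in>{1..n}. 0 :: real)"
  have v0: "v0 \<in> S_up n" by (auto simp: v0_def S_up_def Rn_def)
  \<comment> \<open>Outside this box some coordinate is so far from \<open>z\<close> that its square
    alone makes \<open>f\<close> at least its value at the zero vector.\<close>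
  define B where "B = sqrt (n * f v0) + (\<Sum>i=1..n. \<bar>z i\<bar>)"
  have f_nonneg: "0 \<le> f v" if "v \<in> S_up n" for v
    using coercive[OF that] by (rule order_trans[rotated]) (simp add: sum_nonneg)
  have "0 \<le> B" using f_nonneg[OF v0] by (simp add: B_def sum_nonneg)
  \<comment> \<open>Vectors are functions on all naturals with value \<open>undefined\<close> off
    the index range; singleton factors there make the box a compact product.\<close>
  define K where "K = PiE UNIV (\<lambda>i. if i \<in> {1..n} then {-B..B} else {undefined :: real})"
  have "compact K"
  proof -
    have "compactin (product_topology (\<lambda>i::nat. euclidean :: real topology) UNIV) K"
      unfolding K_def compactin_PiE by auto
    then show ?thesis by (simp add: euclidean_product_topology)
  qed
  define M where "M = K \<inter> (\<Inter>i\<in>{1..<n}. {v. v i \<le> v (i + 1)})"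
  have "closed {v :: nat \<Rightarrow> real. v i \<le> v (i + 1)}" for i
    by (rule closed_Collect_le[OF continuous_on_product_coordinates continuous_on_product_coordinates])
  then have "closed (\<Inter>i\<in>{1..<n}. {v :: nat \<Rightarrow> real. v i \<le> v (i + 1)})"
    by (rule closed_INT[OF ballI])
  then have "compact M"
    unfolding M_def by (rule compact_Int_closed[OF \<open>compact K\<close>])
  have K_Rn: "v \<in> Rn n" if "v \<in> K" for v
  proof -
    have mem: "v i \<in> (if i \<in> {1..n} then {-B..B} else {undefined})" for i
      using that by (simp only: K_def PiE_iff UNIV_I ball_UNIV)
    have "v i = undefined" if "i \<notin> {1..n}" for i
      using mem[of i] unfolding if_not_P[OF that] by (rule singletonD)
    then show ?thesis unfolding Rn_def PiE_iff extensional_def by blast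
  qed
  have M_S: "v \<in> S_up n" if "v \<in> M" for v
    using that K_Rn by (auto simp: M_def S_up_def)
  have "v0 \<in> M"
    using v0 \<open>0 \<le> B\<close> by (auto simp: M_def K_def v0_def)
  then obtain p where p: "p \<in> M" "\<And>v. v \<in> M \<Longrightarrow> F p \<le> F v"
    using continuous_attains_inf[OF \<open>compact M\<close> _ continuous_on_subset[OF F(1)]] by blast
  have "f p \<le> f v" if v: "v \<in> S_up n" for v
  proof (cases "v \<in> M")
    case True
    then show ?thesis using p M_S F(2) by simp
  next
    case False
    then have "v \<notin> K" using v by (auto simp: M_def S_up_def)
    then obtain i where i: "i \<in> {1..n}" "v i \<notin> {-B..B}"
      using v by (auto simp: K_def S_up_def Rn_def PiE_iff extensional_def split: if_splits)
    have "\<bar>z i\<bar> \<le> (\<Sum>i=1..n. \<bar>z i\<bar>)" using i by (intro member_le_sum) auto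
    then have "sqrt (n * f v0) \<le> \<bar>v i - z i\<bar>" using i by (auto simp: B_def)
    then have "n * f v0 \<le> (v i - z i)\<^sup>2"
      using f_nonneg[OF v0] by (metis power2_abs real_sqrt_ge_zero real_sqrt_pow2 power_mono mult_nonneg_nonneg of_nat_0_le_iff)
    also have "\<dots> \<le> (\<Sum>i=1..n. (v i - z i)\<^sup>2)"
      using i by (intro member_le_sum[where f = "\<lambda>i. (v i - z i)\<^sup>2"]) auto
    finally have "f v0 \<le> (\<Sum>i=1..n. (v i - z i)\<^sup>2) / n"
      using \<open>1 \<le> n\<close> by (simp add: field_simps)
    also have "\<dots> \<le> f v" by (rule coercive[OF v])
    finally have "f v0 \<le> f v" .
    moreover have "f p \<le> f v0" using p \<open>v0 \<in> M\<close> M_S F(2) by simp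
    ultimately show ?thesis by simp
  qed
  then have "is_arg_min f (\<lambda>v. v \<in> S_up n) p"
    using M_S[OF p(1)] by (auto simp: is_arg_min_linorder)
  then have "is_arg_min f (\<lambda>v. v \<in> S_up n) (arg_min_on f (S_up n))"
    unfolding arg_min_on_def arg_min_def by (rule someI[where P = "is_arg_min f (\<lambda>v. v \<in> S_up n)"])
  then show "arg_min_on f (S_up n) \<in> S_up n" "v \<in> S_up n \<Longrightarrow> f (arg_min_on f (S_up n)) \<le> f v"
    by (auto simp: is_arg_min_linorder)
qed

lemma
  assumes "1 \<le> n"
  shows LSE_in_S_up: "LSE n (S_up n) y \<in> S_up n"
    and LSE_le: "v \<in> S_up n \<Longrightarrow> (\<Sum>i=1..n. (y i - LSE n (S_up n) y i)\<^sup>2) \<le> (\<Sum>i=1..n. (y i - v i)\<^sup>2)"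
proof -
  let ?f = "\<lambda>v. (scaled_norm n (vdiff n y v))\<^sup>2"
  have cont: "continuous_on UNIV (\<lambda>v::nat \<Rightarrow> real. (\<Sum>i=1..n. (y i - v i)\<^sup>2) / n)"
    by (intro continuous_intros continuous_on_product_coordinates) (use assms in auto)
  have le: "(\<Sum>i=1..n. (v i - y i)\<^sup>2) / n \<le> ?f v" for v
    by (simp add: scaled_norm_vdiff_sq power2_commute)
  show "LSE n (S_up n) y \<in> S_up n"
    unfolding LSE_def by (rule arg_min_on_S_up[OF assms cont _ le]) (rule scaled_norm_vdiff_sq)
  assume "v \<in> S_up n"
  then have "?f (LSE n (S_up n) y) \<le> ?f v"
    unfolding LSE_def by (intro arg_min_on_S_up(2)[OF assms cont _ le]) (auto simp: scaled_norm_vdiff_sq)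
  then show "(\<Sum>i=1..n. (y i - LSE n (S_up n) y i)\<^sup>2) \<le> (\<Sum>i=1..n. (y i - v i)\<^sup>2)"
    using assms by (simp add: scaled_norm_vdiff_sq field_simps)
qed

text \<open>The obtuse-angle criterion for a projection, from comparing \<open>p\<close> with points
  on the segment towards \<open>v\<close>.\<close>

lemma LSE_variational:
  fixes y v :: "nat \<Rightarrow> real"
  assumes "1 \<le> n" "v \<in> S_up n"
  defines "p \<equiv> LSE n (S_up n) y"
  shows "(\<Sum>i=1..n. (y i - p i) * (v i - p i)) \<le> 0"
proof -
  define a b where "a = (\<Sum>i=1..n. (y i - p i) * (v i - p i))" and "b = (\<Sum>i=1..n. (v i - p i)\<^sup>2)"
  have p: "p \<in> S_up n" unfolding p_def by (rule LSE_in_S_up[OF assms(1)])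
  have "b \<ge> 0" by (simp add: b_def sum_nonneg)
  have step: "2 * a \<le> t * b" if "0 < t" "t \<le> 1" for t
  proof -
    have "(\<Sum>i=1..n. (y i - p i)\<^sup>2) \<le> (\<Sum>i=1..n. (y i - (\<lambda>i\<in>{1..n}. p i + t * (v i - p i)) i)\<^sup>2)"
      unfolding p_def
      by (rule LSE_le[OF assms(1) S_up_convex_comb]) (use p assms(2) that in \<open>auto simp: p_def\<close>)
    also have "\<dots> = (\<Sum>i=1..n. (y i - p i)\<^sup>2 - 2 * t * ((y i - p i) * (v i - p i)) + t\<^sup>2 * (v i - p i)\<^sup>2)"
      by (intro sum.cong) (auto simp: power2_eq_square algebra_simps)
    also have "\<dots> = (\<Sum>i=1..n. (y i - p i)\<^sup>2) - 2 * t * a + t\<^sup>2 * b"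
      by (simp add: a_def b_def sum.distrib sum_subtractf sum_distrib_left)
    finally have "t * (2 * a) \<le> t * (t * b)" by (simp add: power2_eq_square algebra_simps)
    then show ?thesis using that by simp
  qed
  have "a \<le> 0"
  proof (rule ccontr)
    assume "\<not> a \<le> 0"
    \<comment> \<open>Small enough that \<open>t * b\<close> is at most \<open>a\<close>, which
      contradicts \<open>2 * a \<le> t * b\<close> for positive \<open>a\<close>; adding 1 covers
      \<open>b = 0\<close>.\<close>
    define t where "t = min 1 (a / (b + 1))"
    have t: "0 < t" "t \<le> 1" using \<open>\<not> a \<le> 0\<close> \<open>b \<ge> 0\<close> by (auto simp: t_def)
    have "t * b \<le> a / (b + 1) * b" using \<open>b \<ge> 0\<close> by (intro mult_right_mono) (auto simp: t_def)
    also have "\<dots> \<le> a" using \<open>\<not> a \<le> 0\<close> \<open>b \<ge> 0\<close> by (simp add: field_simps)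
    finally show False using step[OF t] \<open>\<not> a \<le> 0\<close> by simp
  qed
  then show ?thesis by (simp add: a_def)
qed

text \<open>Its purpose is measurability: the estimator is defined by choice, but contraction makes
  it continuous in the data.\<close>

lemma LSE_nonexpansive:
  assumes "1 \<le> n"
  defines "p \<equiv> LSE n (S_up n)"
  shows "(\<Sum>i=1..n. (p y i - p y' i)\<^sup>2) \<le> (\<Sum>i=1..n. (y i - y' i)\<^sup>2)"
proof -
  have "(\<Sum>i=1..n. (y i - p y i) * (p y' i - p y i)) \<le> 0" "(\<Sum>i=1..n. (y' i - p y' i) * (p y i - p y' i)) \<le> 0"
    unfolding p_def by (intro LSE_variational LSE_in_S_up assms)+
  moreover have "0 \<le> (\<Sum>i=1..n. ((y i - y' i) - (p y i - p y' i))\<^sup>2)" by (simp add: sum_nonneg)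
  moreover have "(\<Sum>i=1..n. ((y i - y' i) - (p y i - p y' i))\<^sup>2) =
      (\<Sum>i=1..n. (y i - y' i)\<^sup>2) - (\<Sum>i=1..n. (p y i - p y' i)\<^sup>2)
      + 2 * ((\<Sum>i=1..n. (y i - p y i) * (p y' i - p y i)) + (\<Sum>i=1..n. (y' i - p y' i) * (p y i - p y' i)))"
    unfolding sum.distrib[symmetric] sum_subtractf[symmetric] sum_distrib_left
    by (intro sum.cong) (auto simp: power2_eq_square algebra_simps)
  ultimately show ?thesis by argo
qed

text \<open>The obtuse angle, rather than mere minimality, supplies the negative square of the
  distance from \<open>p\<close> to \<open>u\<close>, on which all later noise bounds draw.\<close>

lemma LSE_basic_inequality:
  fixes y u \<mu> \<xi> :: "nat \<Rightarrow> real"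
  assumes "1 \<le> n" "u \<in> S_up n" and y: "\<And>i. i \<in> {1..n} \<Longrightarrow> y i = \<mu> i + \<xi> i"
  defines "p \<equiv> LSE n (S_up n) y"
  shows "(\<Sum>i=1..n. (p i - \<mu> i)\<^sup>2) - (\<Sum>i=1..n. (u i - \<mu> i)\<^sup>2)
      \<le> 2 * (\<Sum>i=1..n. \<xi> i * (p i - u i)) - (\<Sum>i=1..n. (p i - u i)\<^sup>2)"
proof -
  have "(\<Sum>i=1..n. (y i - p i) * (u i - p i)) \<le> 0"
    unfolding p_def by (rule LSE_variational[OF assms(1,2)])
  moreover have "(\<Sum>i=1..n. (p i - \<mu> i)\<^sup>2) - (\<Sum>i=1..n. (u i - \<mu> i)\<^sup>2)
      = 2 * (\<Sum>i=1..n. \<xi> i * (p i - u i)) - (\<Sum>i=1..n. (p i - u i)\<^sup>2) + 2 * (\<Sum>i=1..n. (y i - p i) * (u i - p i))"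
    unfolding sum.distrib[symmetric] sum_subtractf[symmetric] sum_distrib_left
    by (intro sum.cong) (auto simp: y power2_eq_square algebra_simps)
  ultimately show ?thesis by linarith
qed

section \<open>Measurability of the estimator\<close>

lemma borel_measurable_PiM_lipschitz:
  fixes f :: "(nat \<Rightarrow> real) \<Rightarrow> real"
  assumes "finite I" and lip: "\<And>x y. \<bar>f x - f y\<bar> \<le> (\<Sum>i\<in>I. \<bar>x i - y i\<bar>)"
  shows "f \<in> borel_measurable (\<Pi>\<^sub>M i\<in>I. borel)"
proof -
  \<comment> \<open>Padding by zero transfers from the finite product to the product over all
    naturals, whose sigma-algebra is the Borel one. The Lipschitz bound sees only coordinates in
    \<open>I\<close>, so \<open>f\<close> does not notice the padding.\<close>
  define e where "e = (\<lambda>x :: nat \<Rightarrow> real. \<lambda>i. if i \<in> I then x i else 0)"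
  have "continuous_on UNIV f"
    unfolding continuous_on_eq_continuous_within
  proof
    fix x
    have "isCont (\<lambda>y :: nat \<Rightarrow> real. \<Sum>i\<in>I. \<bar>y i - x i\<bar>) x"
    proof -
      have "continuous_on UNIV (\<lambda>y :: nat \<Rightarrow> real. \<Sum>i\<in>I. \<bar>y i - x i\<bar>)"
        by (intro continuous_intros continuous_on_product_coordinates)
      then show ?thesis by (simp add: continuous_on_eq_continuous_at)
    qed
    then have "((\<lambda>y :: nat \<Rightarrow> real. \<Sum>i\<in>I. \<bar>y i - x i\<bar>) \<longlongrightarrow> 0) (at x)"
      by (simp add: isCont_def)
    then have "((\<lambda>y. f y - f x) \<longlongrightarrow> 0) (at x)"
      by (rule Lim_null_comparison[rotated]) (simp add: lip)
    then show "isCont f x" by (simp add: isCont_def Lim_null[symmetric])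
  qed
  then have [measurable]: "f \<in> borel_measurable borel"
    by (rule borel_measurable_continuous_onI)
  have "e \<in> measurable (\<Pi>\<^sub>M i\<in>I. borel) (\<Pi>\<^sub>M i\<in>UNIV. borel)"
    unfolding e_def
  proof (rule measurable_PiM_single')
    show "(\<lambda>x. if i \<in> I then x i else 0) \<in> borel_measurable (\<Pi>\<^sub>M i\<in>I. borel)" for i
      by (cases "i \<in> I") simp_all
  qed auto
  then have [measurable]: "e \<in> measurable (\<Pi>\<^sub>M i\<in>I. borel) borel"
    by (simp add: sets_PiM_equal_borel cong: measurable_cong_sets)
  have "(\<lambda>x. f (e x)) \<in> borel_measurable (\<Pi>\<^sub>M i\<in>I. borel)" by measurable
  moreover have "f (e x) = f x" for x
    using lip[of "e x" x] by (simp add: e_def)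
  ultimately show ?thesis by simp
qed

lemma LSE_measurable:
  assumes "1 \<le> n" "i \<in> {1..n}"
  shows "(\<lambda>\<xi>. LSE n (S_up n) (vadd n \<mu> \<xi>) i) \<in> borel_measurable (\<Pi>\<^sub>M i\<in>{1..n}. borel)"
proof (rule borel_measurable_PiM_lipschitz)
  fix x y
  let ?p = "\<lambda>\<xi>. LSE n (S_up n) (vadd n \<mu> \<xi>)"
  have "(?p x i - ?p y i)\<^sup>2 \<le> (\<Sum>i=1..n. (?p x i - ?p y i)\<^sup>2)"
    using assms(2) by (intro member_le_sum[where f = "\<lambda>i. (?p x i - ?p y i)\<^sup>2"]) auto
  also have "\<dots> \<le> (\<Sum>i=1..n. (vadd n \<mu> x i - vadd n \<mu> y i)\<^sup>2)"
    by (rule LSE_nonexpansive[OF assms(1)])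
  also have "\<dots> = (\<Sum>i=1..n. (\<bar>x i - y i\<bar>)\<^sup>2)"
    by (intro sum.cong) (auto simp: vadd_def)
  also have "\<dots> \<le> (\<Sum>i=1..n. \<bar>x i - y i\<bar>)\<^sup>2"
    using power_mono[OF L2_set_le_sum[of "{1..n}" "\<lambda>i. \<bar>x i - y i\<bar>"], of 2]
    by (simp add: L2_set_def sum_nonneg)
  finally show "\<bar>?p x i - ?p y i\<bar> \<le> (\<Sum>i=1..n. \<bar>x i - y i\<bar>)"
    by (metis abs_le_square_iff abs_of_nonneg abs_ge_zero sum_nonneg)
qed simp

section \<open>Exponential moments of the noise\<close>

text \<open>An upper bound on a mean through the nonnegative integral, bundled with measurability
  and sign so that it passes through sums without integrability conditions.\<close>

definition mean_le :: "'a measure \<Rightarrow> real \<Rightarrow> ('a \<Rightarrow> real) \<Rightarrow> bool" where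
  "mean_le M c f \<longleftrightarrow> f \<in> borel_measurable M \<and> (\<forall>x. 0 \<le> f x) \<and> 0 \<le> c \<and> (\<integral>\<^sup>+x. f x \<partial>M) \<le> ennreal c"

lemma mean_le_mono: "mean_le M c f \<Longrightarrow> c \<le> d \<Longrightarrow> mean_le M d f"
  by (auto simp: mean_le_def intro: order_trans ennreal_leI)

lemma mean_le_const: "prob_space M \<Longrightarrow> 0 \<le> c \<Longrightarrow> mean_le M c (\<lambda>_. c)"
  by (simp add: mean_le_def prob_space.emeasure_space_1)

lemma mean_le_add:
  assumes "mean_le M c f" "mean_le M d g"
  shows "mean_le M (c + d) (\<lambda>x. f x + g x)"
proof -
  have [measurable]: "f \<in> borel_measurable M" "g \<in> borel_measurable M"
    using assms by (auto simp: mean_le_def)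
  have "(\<integral>\<^sup>+x. ennreal (f x + g x) \<partial>M) = (\<integral>\<^sup>+x. f x \<partial>M) + (\<integral>\<^sup>+x. g x \<partial>M)"
    using assms by (subst nn_integral_add[symmetric]) (auto simp: mean_le_def ennreal_plus)
  also have "\<dots> \<le> ennreal c + ennreal d"
    using assms by (intro add_mono) (auto simp: mean_le_def)
  finally show ?thesis using assms by (auto simp: mean_le_def)
qed

lemma mean_le_cmult:
  assumes "mean_le M c f" "0 \<le> a"
  shows "mean_le M (a * c) (\<lambda>x. a * f x)"
proof -
  have [measurable]: "f \<in> borel_measurable M" using assms by (auto simp: mean_le_def)
  have "(\<integral>\<^sup>+x. ennreal (a * f x) \<partial>M) = ennreal a * (\<integral>\<^sup>+x. f x \<partial>M)"
    using assms by (subst nn_integral_cmult[symmetric]) (auto simp: mean_le_def ennreal_mult)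
  also have "\<dots> \<le> ennreal a * ennreal c"
    using assms by (intro mult_left_mono) (auto simp: mean_le_def)
  finally show ?thesis using assms by (auto simp: mean_le_def ennreal_mult)
qed

lemma mean_le_sum:
  assumes "finite J" "\<And>j. j \<in> J \<Longrightarrow> mean_le M (c j) (f j)"
  shows "mean_le M (\<Sum>j\<in>J. c j) (\<lambda>x. \<Sum>j\<in>J. f j x)"
  using assms
proof (induction J rule: finite_induct)
  case empty
  then show ?case by (simp add: mean_le_def)
next
  case (insert j J)
  then show ?case by (simp add: mean_le_add)
qed

text \<open>Jensen's inequality through the tangent of exp(-t/4) at \<open>c\<close>. The tangent
  bound is written with sums of nonnegative terms only, and the common finite term is cancelled at
  the end.\<close>

lemma exp_mean_lower_bound:
  assumes "prob_space M" "mean_le M c f"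
  shows "ennreal (exp (- c / 4)) \<le> (\<integral>\<^sup>+x. exp (- f x / 4) \<partial>M)"
proof -
  define e where "e = exp (- c / 4)"
  have "e > 0" by (simp add: e_def)
  have [measurable]: "f \<in> borel_measurable M" and f: "\<And>x. 0 \<le> f x" "0 \<le> c"
      "(\<integral>\<^sup>+x. f x \<partial>M) \<le> ennreal c"
    using assms by (auto simp: mean_le_def)
  have tangent: "e * (1 + c / 4) \<le> exp (- f x / 4) + e / 4 * f x" for x
  proof -
    have "1 + (c - f x) / 4 \<le> exp ((c - f x) / 4)" by (rule exp_ge_add_one_self)
    then have "e * (1 + (c - f x) / 4) \<le> e * exp ((c - f x) / 4)"
      using \<open>e > 0\<close> by simp
    also have "\<dots> = exp (- f x / 4)" by (simp add: e_def mult_exp_exp diff_divide_distrib)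
    finally show ?thesis by (simp add: algebra_simps add_divide_distrib diff_divide_distrib)
  qed
  have "ennreal (e * (1 + c / 4)) = (\<integral>\<^sup>+x. ennreal (e * (1 + c / 4)) \<partial>M)"
    using assms(1) by (simp add: prob_space.emeasure_space_1)
  also have "\<dots> \<le> (\<integral>\<^sup>+x. ennreal (exp (- f x / 4)) + ennreal (e / 4) * ennreal (f x) \<partial>M)"
  proof (intro nn_integral_mono)
    fix x
    have "ennreal (e * (1 + c / 4)) \<le> ennreal (exp (- f x / 4) + e / 4 * f x)"
      by (intro ennreal_leI tangent)
    then show "ennreal (e * (1 + c / 4)) \<le> ennreal (exp (- f x / 4)) + ennreal (e / 4) * ennreal (f x)"
      using \<open>e > 0\<close> f(1)[of x] by (simp add: ennreal_plus ennreal_mult[symmetric] del: ennreal_mult')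
  qed
  also have "\<dots> = (\<integral>\<^sup>+x. exp (- f x / 4) \<partial>M) + ennreal (e / 4) * (\<integral>\<^sup>+x. f x \<partial>M)"
    by (simp add: nn_integral_add nn_integral_cmult)
  also have "\<dots> \<le> (\<integral>\<^sup>+x. exp (- f x / 4) \<partial>M) + ennreal (e / 4) * ennreal c"
    using f by (intro add_left_mono mult_left_mono) auto
  finally have *: "ennreal (e * (1 + c / 4)) \<le> (\<integral>\<^sup>+x. exp (- f x / 4) \<partial>M) + ennreal (e / 4 * c)"
    using \<open>e > 0\<close> f(2) by (subst (asm) ennreal_mult[symmetric]) auto
  have "ennreal (e * (1 + c / 4)) = ennreal e + ennreal (e / 4 * c)"
    using \<open>e > 0\<close> f by (simp add: algebra_simps flip: ennreal_plus)
  then have "ennreal (e / 4 * c) + ennreal e \<le> ennreal (e / 4 * c) + (\<integral>\<^sup>+x. exp (- f x / 4) \<partial>M)"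
    using * by (simp only: add.commute)
  then show ?thesis
    unfolding ennreal_add_left_cancel_le e_def by simp
qed

section \<open>Gaussian exponential moments\<close>

text \<open>Exponential tilting of a centred normal density gives the normal density with mean
  \<open>\<sigma>\<^sup>2 * s\<close>, up to a factor.\<close>

lemma nn_integral_normal_mgf:
  assumes "\<sigma> > 0"
  shows "(\<integral>\<^sup>+t. exp (s * t) \<partial>density lborel (\<lambda>t. ennreal (normal_density 0 \<sigma> t))) = ennreal (exp (\<sigma>\<^sup>2 * s\<^sup>2 / 2))"
proof -
  have "normal_density 0 \<sigma> t * exp (s * t) = exp (\<sigma>\<^sup>2 * s\<^sup>2 / 2) * normal_density (\<sigma>\<^sup>2 * s) \<sigma> t" for t
  proof -
    have "- t\<^sup>2 / (2 * \<sigma>\<^sup>2) + s * t = \<sigma>\<^sup>2 * s\<^sup>2 / 2 + - (t - \<sigma>\<^sup>2 * s)\<^sup>2 / (2 * \<sigma>\<^sup>2)"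
      using assms by (simp add: field_simps power2_eq_square)
    then have "exp (- t\<^sup>2 / (2 * \<sigma>\<^sup>2)) * exp (s * t) = exp (\<sigma>\<^sup>2 * s\<^sup>2 / 2) * exp (- (t - \<sigma>\<^sup>2 * s)\<^sup>2 / (2 * \<sigma>\<^sup>2))"
      by (metis exp_add)
    then show ?thesis by (simp add: normal_density_def field_simps)
  qed
  then have "ennreal (normal_density 0 \<sigma> t) * ennreal (exp (s * t))
      = ennreal (exp (\<sigma>\<^sup>2 * s\<^sup>2 / 2)) * ennreal (normal_density (\<sigma>\<^sup>2 * s) \<sigma> t)" for t
    by (simp flip: ennreal_mult)
  then have "(\<integral>\<^sup>+t. exp (s * t) \<partial>density lborel (\<lambda>t. ennreal (normal_density 0 \<sigma> t)))
      = ennreal (exp (\<sigma>\<^sup>2 * s\<^sup>2 / 2)) * (\<integral>\<^sup>+t. normal_density (\<sigma>\<^sup>2 * s) \<sigma> t \<partial>lborel)"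
    by (simp add: nn_integral_density nn_integral_cmult)
  also have "(\<integral>\<^sup>+t. normal_density (\<sigma>\<^sup>2 * s) \<sigma> t \<partial>lborel) = 1"
    using prob_space.emeasure_space_1[OF prob_space_normal_density[OF assms, of "\<sigma>\<^sup>2 * s"]]
    by (simp add: emeasure_density)
  finally show ?thesis by simp
qed

lemma prob_space_gaussian_noise: "\<sigma> > 0 \<Longrightarrow> prob_space (gaussian_noise n \<sigma>)"
  unfolding gaussian_noise_def by (intro prob_space_PiM prob_space_normal_density)

lemma borel_measurable_gaussian_noise_iff:
  "f \<in> borel_measurable (gaussian_noise n \<sigma>) \<longleftrightarrow> f \<in> borel_measurable (\<Pi>\<^sub>M i\<in>{1..n}. borel)"
  by (simp add: measurable_cong_sets[OF sets_gaussian_noise refl])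

lemma gaussian_noise_mgf:
  assumes "\<sigma> > 0"
  shows "(\<integral>\<^sup>+\<xi>. exp (\<Sum>i=1..n. w i * \<xi> i) \<partial>gaussian_noise n \<sigma>) = ennreal (exp (\<sigma>\<^sup>2 / 2 * (\<Sum>i=1..n. (w i)\<^sup>2)))"
proof -
  let ?N = "density lborel (\<lambda>t. ennreal (normal_density 0 \<sigma> t))"
  interpret N: prob_space ?N by (rule prob_space_normal_density[OF assms])
  interpret P: product_sigma_finite "\<lambda>_::nat. ?N" by standard
  have "(\<integral>\<^sup>+\<xi>. exp (\<Sum>i=1..n. w i * \<xi> i) \<partial>gaussian_noise n \<sigma>)
      = (\<integral>\<^sup>+\<xi>. (\<Prod>i\<in>{1..n}. ennreal (exp (w i * \<xi> i))) \<partial>(\<Pi>\<^sub>M i\<in>{1..n}. ?N))"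
    unfolding gaussian_noise_def by (simp add: exp_sum prod_ennreal)
  also have "\<dots> = (\<Prod>i\<in>{1..n}. \<integral>\<^sup>+t. exp (w i * t) \<partial>?N)"
    by (intro P.product_nn_integral_prod[where f = "\<lambda>i t. ennreal (exp (w i * t))"]) auto
  also have "\<dots> = (\<Prod>i\<in>{1..n}. ennreal (exp (\<sigma>\<^sup>2 * (w i)\<^sup>2 / 2)))"
    by (simp only: nn_integral_normal_mgf[OF assms])
  also have "\<dots> = ennreal (exp (\<sigma>\<^sup>2 / 2 * (\<Sum>i=1..n. (w i)\<^sup>2)))"
    by (simp add: prod_ennreal exp_sum[symmetric] sum_distrib_left field_simps)
  finally show ?thesis .
qed

text \<open>The form has variance at most 1, so each of the two exponentials has mean at most
  exp(1/2), which is below 2.\<close>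

lemma mean_le_cosh2_linear_form:
  assumes "\<sigma> > 0" and w: "(\<Sum>i=1..n. (w i)\<^sup>2) \<le> 1"
    and f: "\<And>x. f x = (\<Sum>i=1..n. w i * x i)"
  shows "mean_le (gaussian_noise n \<sigma>) 4 (\<lambda>\<xi>. cosh2 (f (\<lambda>i. \<xi> i / \<sigma>)))"
proof -
  have meas: "(\<lambda>\<xi>. exp (\<Sum>i=1..n. a i * \<xi> i)) \<in> borel_measurable (gaussian_noise n \<sigma>)" for a :: "nat \<Rightarrow> real"
    unfolding borel_measurable_gaussian_noise_iff
    by (intro measurable_compose[OF _ borel_measurable_exp] borel_measurable_sum borel_measurable_times
        borel_measurable_const measurable_component_singleton) auto
  have half: "mean_le (gaussian_noise n \<sigma>) 2 (\<lambda>\<xi>. exp (\<Sum>i=1..n. a i * \<xi> i))"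
    if "\<sigma>\<^sup>2 * (\<Sum>i=1..n. (a i)\<^sup>2) \<le> 1" for a
  proof -
    have "exp (\<sigma>\<^sup>2 / 2 * (\<Sum>i=1..n. (a i)\<^sup>2)) \<le> exp (1/2)"
      using that by simp
    also have "exp (1/2 :: real) \<le> 2"
    proof -
      have "(exp (1/2 :: real))\<^sup>2 = exp 1" by (simp flip: exp_double)
      also have "\<dots> \<le> 2\<^sup>2" using exp_le by simp
      finally show ?thesis by (rule power2_le_imp_le) simp
    qed
    finally have "ennreal (exp (\<sigma>\<^sup>2 / 2 * (\<Sum>i=1..n. (a i)\<^sup>2))) \<le> ennreal 2"
      by (rule ennreal_leI)
    then show ?thesis
      unfolding mean_le_def gaussian_noise_mgf[OF assms(1)] using meas[of a] by simp
  qed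
  have w': "\<sigma>\<^sup>2 * (\<Sum>i=1..n. (w i / \<sigma>)\<^sup>2) \<le> 1"
    using w \<open>\<sigma> > 0\<close> by (simp add: power_divide flip: sum_divide_distrib)
  have w'': "\<sigma>\<^sup>2 * (\<Sum>i=1..n. (- w i / \<sigma>)\<^sup>2) \<le> 1"
    using w' by simp
  have "mean_le (gaussian_noise n \<sigma>) (2 + 2) (\<lambda>\<xi>. exp (\<Sum>i=1..n. w i / \<sigma> * \<xi> i) + exp (\<Sum>i=1..n. - w i / \<sigma> * \<xi> i))"
    by (intro mean_le_add half w' w'')
  then show ?thesis by (simp add: cosh2_def f sum_negf)
qed

section \<open>Geometric sums over dyadic levels\<close>

text \<open>Below \<open>L\<close> the factor \<open>sqrt (2 ^ l)\<close> decays geometrically and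
  beats the linear thresholds, so the top level dominates and no logarithm appears. The constant is
  twice the derivative of the geometric series at 1/sqrt 2.\<close>

lemma haar_level_sum_le:
  "\<exists>C>0. \<forall>L. (\<Sum>l<L. 2 * real (L - l) * sqrt (2 ^ l)) \<le> C * sqrt (2 ^ L)"
proof -
  define z where "z = 1 / sqrt (2::real)"
  have z: "0 < z" "z < 1" by (simp_all add: z_def)
  have sums: "(\<lambda>i. real (Suc i) * z ^ i) sums (1 / (1 - z)\<^sup>2)"
    using geometric_deriv_sums[of z] z by simp
  have "(\<Sum>l<L. 2 * real (L - l) * sqrt (2 ^ l)) \<le> 2 / (1 - z)\<^sup>2 * sqrt (2 ^ L)" for L
  proof -
    have "2 * real (L - l) * sqrt (2 ^ l) \<le> 2 * sqrt (2 ^ L) * (real (Suc (L - Suc l)) * z ^ (L - Suc l))" if "l < L" for l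
    proof -
      have "sqrt (2 ^ l) = sqrt (2 ^ L) * z ^ (L - l)"
      proof -
        have "sqrt (2 ^ L) = sqrt 2 ^ l * sqrt 2 ^ (L - l)"
          using that by (simp add: real_sqrt_power flip: power_add)
        then show ?thesis by (simp add: z_def power_divide real_sqrt_power)
      qed
      also have "\<dots> \<le> sqrt (2 ^ L) * z ^ (L - Suc l)"
        using z by (intro mult_left_mono power_decreasing) auto
      finally have "real (L - l) * sqrt (2 ^ l) \<le> real (L - l) * (sqrt (2 ^ L) * z ^ (L - Suc l))"
        by (intro mult_left_mono) auto
      moreover have "L - l = Suc (L - Suc l)" using that by simp
      ultimately show ?thesis by (simp add: algebra_simps del: of_nat_Suc)
    qed
    then have "(\<Sum>l<L. 2 * real (L - l) * sqrt (2 ^ l))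
        \<le> (\<Sum>l<L. 2 * sqrt (2 ^ L) * (real (Suc (L - Suc l)) * z ^ (L - Suc l)))"
      by (intro sum_mono) auto
    also have "\<dots> = 2 * sqrt (2 ^ L) * (\<Sum>i<L. real (Suc i) * z ^ i)"
      unfolding sum_distrib_left[symmetric]
      using sum.nat_diff_reindex[of "\<lambda>i. real (Suc i) * z ^ i" L] by simp
    also have "\<dots> \<le> 2 * sqrt (2 ^ L) * (1 / (1 - z)\<^sup>2)"
    proof (rule mult_left_mono)
      show "(\<Sum>i<L. real (Suc i) * z ^ i) \<le> 1 / (1 - z)\<^sup>2"
        unfolding sums_unique[OF sums] using z by (intro sum_le_suminf sums_summable[OF sums]) auto
    qed simp
    finally show ?thesis by simp
  qed
  moreover have "2 / (1 - z)\<^sup>2 > 0" using z by simp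
  ultimately show ?thesis by blast
qed

text \<open>Each step down doubles the number of coefficients and divides the weight by e; the ratio
  2/e is below 1.\<close>

lemma haar_level_mass_le:
  "\<exists>C>0. \<forall>L P. L \<le> P \<longrightarrow> (\<Sum>l<L. exp (- real (L - l)) * 2 ^ (P - Suc l)) \<le> C * 2 ^ (P - L)"
proof -
  define z where "z = 2 * exp (- 1 :: real)"
  have z: "0 < z" "z < 1"
    using exp_ge_add_one_self_aux[of 1] exp_lower_Taylor_quadratic[of 1]
    by (auto simp: z_def exp_minus field_simps)
  have "(\<Sum>l<L. exp (- real (L - l)) * 2 ^ (P - Suc l)) \<le> 1 / (1 - z) * 2 ^ (P - L)" if "L \<le> P" for L P
  proof -
    have "exp (- real (L - l)) * 2 ^ (P - Suc l) \<le> 2 ^ (P - L) * z ^ (L - Suc l)" if "l < L" for l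
    proof -
      have "P - Suc l = (P - L) + (L - Suc l)" using \<open>L \<le> P\<close> that by simp
      then have "2 ^ (P - Suc l) = (2::real) ^ (P - L) * 2 ^ (L - Suc l)" by (simp add: power_add)
      moreover have "exp (- real (L - l)) \<le> exp (- 1) ^ (L - Suc l)"
        using that by (simp flip: exp_of_nat_mult)
      then have "2 ^ (P - L) * 2 ^ (L - Suc l) * exp (- real (L - l))
          \<le> 2 ^ (P - L) * 2 ^ (L - Suc l) * exp (- 1 :: real) ^ (L - Suc l)"
        by (intro mult_left_mono) auto
      ultimately show ?thesis by (simp add: z_def power_mult_distrib mult_ac)
    qed
    then have "(\<Sum>l<L. exp (- real (L - l)) * 2 ^ (P - Suc l)) \<le> (\<Sum>l<L. 2 ^ (P - L) * z ^ (L - Suc l))"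
      by (intro sum_mono) auto
    also have "\<dots> = 2 ^ (P - L) * (\<Sum>i<L. z ^ i)"
      unfolding sum_distrib_left[symmetric] using sum.nat_diff_reindex[of "\<lambda>i. z ^ i" L] by simp
    also have "\<dots> \<le> 2 ^ (P - L) * (1 / (1 - z))"
    proof (rule mult_left_mono)
      have sums: "(\<lambda>i. z ^ i) sums (1 / (1 - z))" using z geometric_sums[of z] by simp
      show "(\<Sum>i<L. z ^ i) \<le> 1 / (1 - z)"
        unfolding sums_unique[OF sums] using z by (intro sum_le_suminf sums_summable[OF sums]) auto
    qed simp
    finally show ?thesis by simp
  qed
  moreover have "1 / (1 - z) > 0" using z by simp
  ultimately show ?thesis by blast
qed

section \<open>The oracle inequality\<close>

lemma isotonic_envelope:
  "\<exists>C\<ge>1. \<forall>n \<sigma> u. 1 \<le> n \<longrightarrow> \<sigma> > 0 \<longrightarrow> u \<in> S_up n \<longrightarrow>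
     (\<exists>R. mean_le (gaussian_noise n \<sigma>) (C * (real n * ((\<sigma> + V n u) / (\<sigma> * real n)) powr (2/3))) R \<and>
       (\<forall>\<xi>. \<forall>v\<in>S_up n. 2 * (\<Sum>i=1..n. \<xi> i * (v i - u i)) - (\<Sum>i=1..n. (v i - u i)\<^sup>2) \<le> \<sigma>\<^sup>2 * R \<xi>))"
proof -
  obtain C1 where "C1 > 0" and C1: "\<And>L. (\<Sum>l<L. 2 * real (L - l) * sqrt (2 ^ l)) \<le> C1 * sqrt (2 ^ L)"
    using haar_level_sum_le by blast
  obtain C2 where "C2 > 0" and C2: "\<And>L P. L \<le> P \<Longrightarrow> (\<Sum>l<L. exp (- real (L - l)) * 2 ^ (P - Suc l)) \<le> C2 * 2 ^ (P - L)"
    using haar_level_mass_le by blast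
  \<comment> \<open>The first two terms bound the variation cost; 128 is 64 for the outer indices
    plus 64 for the coarse blocks, and the last term covers the finer levels.\<close>
  define C where "C = 2 * C1 + 2 * C1\<^sup>2 + 128 + 64 * C2"
  have "C \<ge> 64" using \<open>C1 > 0\<close> \<open>C2 > 0\<close> by (simp add: C_def)
  have "\<exists>R. mean_le (gaussian_noise n \<sigma>) (C * (real n * ((\<sigma> + V n u) / (\<sigma> * real n)) powr (2/3))) R \<and>
       (\<forall>\<xi>. \<forall>v\<in>S_up n. 2 * (\<Sum>i=1..n. \<xi> i * (v i - u i)) - (\<Sum>i=1..n. (v i - u i)\<^sup>2) \<le> \<sigma>\<^sup>2 * R \<xi>)"
    if n: "1 \<le> n" and \<sigma>: "\<sigma> > 0" and u: "u \<in> S_up n" for n \<sigma> u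
  proof -
    interpret prob_space "gaussian_noise n \<sigma>" by (rule prob_space_gaussian_noise[OF \<sigma>])
    let ?mean = "mean_le (gaussian_noise n \<sigma>)"
    \<comment> \<open>Variation in units of the noise. With \<open>r\<close> the cube root of
      \<open>a / n\<close>, the balance point is \<open>m\<close>, the block length is of order
      \<open>1 / r\<^sup>2\<close>, and \<open>S\<close> is of order \<open>1 / r\<close>, so that
      \<open>S\<close> times \<open>a\<close> is of order \<open>m\<close>.\<close>
    define a where "a = 1 + V n u / \<sigma>"
    define r where "r = (a / n) powr (1/3)"
    define m where "m = n * r\<^sup>2"
    have V: "V n u = u n - u 1" "0 \<le> V n u"
      using V_S_up[OF u n] S_up_mono[OF u, of 1 n] n by auto
    have a: "a \<ge> 1" using V \<sigma> by (simp add: a_def)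
    have "r > 0" using a n by (simp add: r_def)
    have r3: "n * r ^ 3 = a"
    proof -
      have "r ^ 3 = (a / n) powr (real 3 * (1/3))"
        using a n unfolding r_def by (subst powr_power) auto
      then show ?thesis using a n by simp
    qed
    have m_eq: "real n * ((\<sigma> + V n u) / (\<sigma> * real n)) powr (2/3) = m"
    proof -
      have "(\<sigma> + V n u) / (\<sigma> * real n) = a / n" using \<sigma> by (simp add: a_def field_simps)
      moreover have "(a / n) powr (2/3) = r\<^sup>2"
        using a n unfolding r_def by (subst powr_power) auto
      ultimately show ?thesis by (simp add: m_def)
    qed
    have "m > 0" using n \<open>r > 0\<close> by (simp add: m_def)
    have m3: "m ^ 3 = n * a\<^sup>2"
      unfolding r3[symmetric] m_def by (simp add: power2_eq_square power3_eq_cube)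
    have a2: "a\<^sup>2 \<ge> 1" using a by simp
    have "m \<ge> 1"
    proof (rule ccontr)
      assume "\<not> m \<ge> 1"
      then have "m ^ 3 < 1" using \<open>m > 0\<close> by (simp add: power_less_one_iff)
      moreover have "1 * 1 \<le> n * a\<^sup>2" using a2 n by (intro mult_mono) auto
      ultimately show False using m3 by simp
    qed
    have ar: "a / r = m" unfolding r3[symmetric] m_def using \<open>r > 0\<close> by (simp add: power2_eq_square power3_eq_cube)
    \<comment> \<open>Controls the overshoot term \<open>S\<^sup>2 / k\<close>. Here
      \<open>a \<ge> 1\<close> enters, that is, the summand \<sigma> next to the variation in the
      penalty.\<close>
    have rm: "1 / (r\<^sup>2 * m) \<le> m"
    proof -
      have "r\<^sup>2 * m * m = a\<^sup>2"
        unfolding r3[symmetric] m_def by (simp add: power2_eq_square power3_eq_cube)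
      then show ?thesis using a2 \<open>m > 0\<close> \<open>r > 0\<close> by (simp add: field_simps)
    qed
    define k where "k = nat \<lceil>m\<rceil>"
    have k: "m \<le> k" "k \<le> m + 1" "1 \<le> k"
      using \<open>m \<ge> 1\<close> unfolding k_def by linarith+
    have scale: "2 * (\<Sum>i=1..n. \<xi> i * (v i - u i)) - (\<Sum>i=1..n. (v i - u i)\<^sup>2)
        = \<sigma>\<^sup>2 * (2 * (\<Sum>i=1..n. \<xi> i / \<sigma> * (v i / \<sigma> - u i / \<sigma>)) - (\<Sum>i=1..n. (v i / \<sigma> - u i / \<sigma>)\<^sup>2))" for \<xi> v
    proof -
      have "\<xi> i / \<sigma> * (v i / \<sigma> - u i / \<sigma>) = \<xi> i * (v i - u i) / \<sigma>\<^sup>2"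
        "(v i / \<sigma> - u i / \<sigma>)\<^sup>2 = (v i - u i)\<^sup>2 / \<sigma>\<^sup>2" for i
        by (auto simp: power2_eq_square diff_divide_distrib[symmetric])
      then show ?thesis using \<sigma>
        by (simp add: sum_divide_distrib[symmetric] right_diff_distrib)
    qed
    have coord: "?mean 4 (\<lambda>\<xi>. cosh2 (\<xi> i / \<sigma>))" if "i \<in> {1..n}" for i
    proof -
      have "?mean 4 (\<lambda>\<xi>. cosh2 ((\<lambda>x. x i) (\<lambda>i. \<xi> i / \<sigma>)))"
        using that by (intro mean_le_cosh2_linear_form[OF \<sigma>, where w = "\<lambda>j. if j = i then 1 else 0"])
          (auto simp: if_distrib if_distribR sum.delta cong: if_cong)
      then show ?thesis by simp
    qed
    have "\<exists>R. ?mean (C * m) R \<and>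
       (\<forall>\<xi>. \<forall>v\<in>S_up n. 2 * (\<Sum>i=1..n. \<xi> i / \<sigma> * (v i / \<sigma> - u i / \<sigma>)) - (\<Sum>i=1..n. (v i / \<sigma> - u i / \<sigma>)\<^sup>2) \<le> R \<xi>)"
    proof (cases "2 * k < n")
      \<comment> \<open>Then \<open>n\<close> is at most \<open>4 * m\<close>, and charging every
        coordinate separately with threshold zero is cheap enough.\<close>
      case False
      define R where "R = (\<lambda>\<xi>. 4 * (\<Sum>i=1..n. cosh2 (\<xi> i / \<sigma>)))"
      have "?mean (4 * (\<Sum>i=1..n. 4)) R"
        unfolding R_def by (intro mean_le_cmult mean_le_sum coord) auto
      moreover have "4 * (\<Sum>i=1..n. 4) \<le> C * m"
      proof -
        have "real n \<le> 4 * m" using False k \<open>m \<ge> 1\<close> by linarith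
        moreover have "64 * m \<le> C * m" using \<open>C \<ge> 64\<close> \<open>m > 0\<close> by (intro mult_right_mono) auto
        ultimately show ?thesis by simp
      qed
      ultimately have "?mean (C * m) R" by (rule mean_le_mono)
      moreover have "2 * (\<Sum>i=1..n. \<xi> i / \<sigma> * (v i / \<sigma> - u i / \<sigma>)) - (\<Sum>i=1..n. (v i / \<sigma> - u i / \<sigma>)\<^sup>2) \<le> R \<xi>" for \<xi> v
        unfolding R_def sum_distrib_left sum_subtractf[symmetric]
      proof (intro sum_mono)
        have "2 * (N * h) - h\<^sup>2 \<le> 4 * cosh2 N" for N h
        proof -
          have "2 * (N * h) - h * h / 2 \<le> 4 * cosh2 N" using soft_threshold_bound[of 0 N h] by simp
          moreover have "0 \<le> h * h" by simp
          ultimately show ?thesis unfolding power2_eq_square by linarith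
        qed
        then show "2 * (\<xi> i / \<sigma> * (v i / \<sigma> - u i / \<sigma>)) - (v i / \<sigma> - u i / \<sigma>)\<^sup>2 \<le> 4 * cosh2 (\<xi> i / \<sigma>)" for i .
      qed
      ultimately show ?thesis by blast
    next
      case True
      define I where "I = {k + 1..n - k}"
      have I: "I \<subseteq> {1..n}" by (auto simp: I_def)
      obtain p where p: "2 ^ p \<le> n" "n < 2 ^ (p + 1)" using ex_power_ivl1[of 2 n] n by auto
      define P where "P = p + 1"
      have P: "n < 2 ^ P" "2 ^ P \<le> 2 * real n"
        using p by (auto simp: P_def numeral_power_le_of_nat_cancel_iff)
      \<comment> \<open>An integer stand-in for \<open>n / m\<close>, so that \<open>2 ^ L\<close>
        becomes the largest power of two not exceeding this ratio.\<close>
      define q where "q = nat \<lfloor>n / m\<rfloor>"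
      have "m < n" using True k by linarith
      then have nm: "1 < n / m" using \<open>m > 0\<close> by simp
      then have q: "1 \<le> q" "real q \<le> n / m" "n / m < real q + 1"
        unfolding q_def by linarith+
      obtain L where L: "2 ^ L \<le> q" "q < 2 ^ (L + 1)" using ex_power_ivl1[of 2 q] q by auto
      have L_le: "2 ^ L \<le> n / m"
      proof -
        have "(2::real) ^ L \<le> q" using L(1) by (simp add: numeral_power_le_of_nat_cancel_iff)
        then show ?thesis using q by linarith
      qed
      have L_gt: "n / m < 2 * 2 ^ L"
      proof -
        have "real (Suc q) \<le> real (2 ^ (L + 1))"
          using L(2) unfolding of_nat_le_iff by simp
        then show ?thesis using q by simp
      qed
      have "(2::real) ^ L < 2 ^ P"
      proof -
        have "n / m \<le> n" using \<open>m \<ge> 1\<close> n by (simp add: field_simps)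
        moreover have "real n < real (2 ^ P)" using P(1) by (simp only: of_nat_less_iff)
        ultimately show ?thesis using L_le unfolding of_nat_power of_nat_numeral by linarith
      qed
      then have "L \<le> P" by simp
      have blocks: "2 ^ (P - L) \<le> 4 * m"
      proof -
        have "2 ^ (P - L) * 2 ^ L = (2::real) ^ P" using \<open>L \<le> P\<close> by (simp flip: power_add)
        also have "\<dots> \<le> 2 * real n" by (rule P)
        also have "\<dots> \<le> 4 * m * 2 ^ L" using L_gt \<open>m > 0\<close> by (simp add: field_simps)
        finally show ?thesis by simp
      qed
      define S where "S = (\<Sum>l<L. 2 * real (L - l) * sqrt (2 ^ l))"
      have "S \<ge> 0" unfolding S_def by (intro sum_nonneg mult_nonneg_nonneg) auto
      have S: "S \<le> C1 / r"
      proof -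
        have "S \<le> C1 * sqrt (2 ^ L)" unfolding S_def by (rule C1)
        also have "\<dots> \<le> C1 * sqrt (n / m)"
          using L_le \<open>C1 > 0\<close> by (intro mult_left_mono real_sqrt_le_mono) auto
        also have "sqrt (n / m) = 1 / r"
          using n \<open>r > 0\<close> by (simp add: m_def real_sqrt_divide)
        finally show ?thesis by simp
      qed
      define d where "d = 2 * S * (u n / \<sigma> - u 1 / \<sigma>) + 2 * S\<^sup>2 / k"
      have V\<sigma>: "0 \<le> u n / \<sigma> - u 1 / \<sigma>" "u n / \<sigma> - u 1 / \<sigma> \<le> a"
        using V \<sigma> by (simp_all add: a_def diff_divide_distrib[symmetric])
      have d: "0 \<le> d" "d \<le> (2 * C1 + 2 * C1\<^sup>2) * m"
      proof -
        show "0 \<le> d" using \<open>S \<ge> 0\<close> V\<sigma> by (simp add: d_def)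
        have "S * (u n / \<sigma> - u 1 / \<sigma>) \<le> C1 / r * a"
          using S V\<sigma> \<open>S \<ge> 0\<close> \<open>C1 > 0\<close> \<open>r > 0\<close> by (intro mult_mono) auto
        also have "\<dots> = C1 * m" by (simp flip: ar)
        finally have 1: "S * (u n / \<sigma> - u 1 / \<sigma>) \<le> C1 * m" .
        have "S\<^sup>2 / k \<le> (C1 / r)\<^sup>2 / m"
          using S \<open>S \<ge> 0\<close> k \<open>m > 0\<close> by (intro frac_le power_mono) auto
        also have "\<dots> = C1\<^sup>2 * (1 / (r\<^sup>2 * m))" by (simp add: power_divide)
        also have "\<dots> \<le> C1\<^sup>2 * m" by (intro mult_left_mono rm) simp
        finally have "S\<^sup>2 / k \<le> C1\<^sup>2 * m" .
        moreover have "d = 2 * (S * (u n / \<sigma> - u 1 / \<sigma>)) + 2 * (S\<^sup>2 / k)" by (simp add: d_def)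
        moreover have "(2 * C1 + 2 * C1\<^sup>2) * m = 2 * (C1 * m) + 2 * (C1\<^sup>2 * m)" by (simp add: algebra_simps)
        ultimately show "d \<le> (2 * C1 + 2 * C1\<^sup>2) * m" using 1 by linarith
      qed
      define R where "R = (\<lambda>\<xi>. d + 4 * (\<Sum>i\<in>{1..n} - I. cosh2 (\<xi> i / \<sigma>))
        + 4 * (\<Sum>j<2 ^ (P - L). cosh2 (block_coeff I L j (\<lambda>i. \<xi> i / \<sigma>)))
        + (\<Sum>l<L. 4 * exp (- real (L - l)) * (\<Sum>j<2 ^ (P - Suc l). cosh2 (haar_coeff I l j (\<lambda>i. \<xi> i / \<sigma>)))))"
      have block_mean: "?mean 4 (\<lambda>\<xi>. cosh2 (block_coeff I l j (\<lambda>i. \<xi> i / \<sigma>)))" for l j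
        using block_coeff_linear_form[OF finite_atLeastAtMost I, of l j] mean_le_cosh2_linear_form[OF \<sigma>] by blast
      have haar_mean: "?mean 4 (\<lambda>\<xi>. cosh2 (haar_coeff I l j (\<lambda>i. \<xi> i / \<sigma>)))" for l j
        using haar_coeff_linear_form[OF finite_atLeastAtMost I, of l j] mean_le_cosh2_linear_form[OF \<sigma>] by blast
      have "?mean (d + 4 * (\<Sum>i\<in>{1..n} - I. 4) + 4 * (\<Sum>j<(2::nat) ^ (P - L). 4)
          + (\<Sum>l<L. 4 * exp (- real (L - l)) * (\<Sum>j<(2::nat) ^ (P - Suc l). 4))) R"
        unfolding R_def using d
        by (intro mean_le_add mean_le_const mean_le_cmult mean_le_sum coord block_mean haar_mean prob_space_axioms) auto
      moreover have "d + 4 * (\<Sum>i\<in>{1..n} - I. 4) + 4 * (\<Sum>j<(2::nat) ^ (P - L). 4)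
          + (\<Sum>l<L. 4 * exp (- real (L - l)) * (\<Sum>j<(2::nat) ^ (P - Suc l). 4)) \<le> C * m"
      proof -
        have "card ({1..n} - I) = 2 * k"
          using I True by (subst card_Diff_subset) (auto simp: I_def)
        then have ends: "(\<Sum>i\<in>{1..n} - I. 4 :: real) \<le> 16 * m"
          using k \<open>m \<ge> 1\<close> by simp
        have "(\<Sum>l<L. 4 * exp (- real (L - l)) * (\<Sum>j<(2::nat) ^ (P - Suc l). 4))
            = 16 * (\<Sum>l<L. exp (- real (L - l)) * 2 ^ (P - Suc l))"
          by (simp add: sum_distrib_left mult_ac)
        also have "\<dots> \<le> 16 * (C2 * 2 ^ (P - L))" using C2[OF \<open>L \<le> P\<close>] by simp
        also have "\<dots> \<le> 16 * (C2 * (4 * m))" using blocks \<open>C2 > 0\<close> by (intro mult_left_mono) auto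
        finally have haar: "(\<Sum>l<L. 4 * exp (- real (L - l)) * (\<Sum>j<(2::nat) ^ (P - Suc l). 4)) \<le> 64 * C2 * m"
          by simp
        have "C * m = (2 * C1 + 2 * C1\<^sup>2) * m + 64 * m + 64 * m + 64 * C2 * m"
          by (simp add: C_def algebra_simps)
        then show ?thesis using d(2) ends blocks haar by simp
      qed
      ultimately have "?mean (C * m) R" by (rule mean_le_mono)
      moreover have "2 * (\<Sum>i=1..n. \<xi> i / \<sigma> * (v i / \<sigma> - u i / \<sigma>)) - (\<Sum>i=1..n. (v i / \<sigma> - u i / \<sigma>)\<^sup>2) \<le> R \<xi>"
        if v: "v \<in> S_up n" for \<xi> v
        unfolding R_def d_def S_def I_def
        by (rule isotonic_noise_bound[OF k(3) True P(1) \<open>L \<le> P\<close>])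
          (use S_up_mono[OF u] S_up_mono[OF v] \<sigma> in \<open>auto intro: divide_right_mono\<close>)
      ultimately show ?thesis by blast
    qed
    then show ?thesis
      unfolding m_eq scale using \<sigma> by (simp add: mult_le_cancel_left_pos)
  qed
  moreover have "C \<ge> 1" using \<open>C \<ge> 64\<close> by simp
  ultimately show ?thesis by blast
qed

section \<open>Exponential moment of the excess loss\<close>

text \<open>\<open>W\<close> needs its bound only along the selection \<open>p\<close>, whereas
  \<open>R\<close> dominates every competitor. This allows \<open>W\<close> at noise
  \<open>x\<close> to be compared with \<open>R\<close> at another noise \<open>y\<close>.\<close>

lemma isotonic_exp_moment_bound:
  fixes W :: "(nat \<Rightarrow> real) \<Rightarrow> real"
  assumes "1 \<le> n" "\<sigma> > 0" "u \<in> S_up n"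
    and R: "mean_le (gaussian_noise n \<sigma>) c R"
      "\<And>\<xi> v. v \<in> S_up n \<Longrightarrow> 2 * (\<Sum>i=1..n. \<xi> i * (v i - u i)) - (\<Sum>i=1..n. (v i - u i)\<^sup>2) \<le> \<sigma>\<^sup>2 * R \<xi>"
    and p: "\<And>\<xi>. p \<xi> \<in> S_up n"
    and W: "W \<in> borel_measurable (gaussian_noise n \<sigma>)"
      "\<And>\<xi>. W \<xi> \<le> 2 * (\<Sum>i=1..n. \<xi> i * (p \<xi> i - u i)) - (\<Sum>i=1..n. (p \<xi> i - u i)\<^sup>2)"
  shows "(\<integral>\<^sup>+\<xi>. exp (W \<xi> / (4 * \<sigma>\<^sup>2)) \<partial>gaussian_noise n \<sigma>) \<le> ennreal (exp (3 / 4 * c))"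
proof -
  let ?M = "gaussian_noise n \<sigma>"
  have [measurable]: "R \<in> borel_measurable ?M" "W \<in> borel_measurable ?M"
    using R W by (auto simp: mean_le_def)
  have key: "W x \<le> 3 * \<sigma>\<^sup>2 * R y + 3 / 2 * (\<Sum>i=1..n. (x i - y i)\<^sup>2)" for x y
  proof -
    define \<theta> where "\<theta> = (\<lambda>i. p x i - u i)"
    \<comment> \<open>The factor 1/3 is the ratio of the weights 1/4 and 3/4. It leaves the linear
      terms equal up to \<open>x - y\<close> and saves two thirds of the quadratic term, which pays
      for that difference.\<close>
    have "(\<lambda>i\<in>{1..n}. u i + 1/3 * (p x i - u i)) \<in> S_up n"
      using assms(3) p by (intro S_up_convex_comb) auto
    from R(2)[OF this, of y]
    have "2 * (\<Sum>i=1..n. y i * (\<theta> i / 3)) - (\<Sum>i=1..n. (\<theta> i / 3)\<^sup>2) \<le> \<sigma>\<^sup>2 * R y"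
      by (simp add: \<theta>_def)
    then have "3 * (2 * (\<Sum>i=1..n. y i * (\<theta> i / 3)) - (\<Sum>i=1..n. (\<theta> i / 3)\<^sup>2)) \<le> 3 * \<sigma>\<^sup>2 * R y"
      by simp
    moreover have "W x \<le> 2 * (\<Sum>i=1..n. x i * \<theta> i) - (\<Sum>i=1..n. (\<theta> i)\<^sup>2)"
      unfolding \<theta>_def by (rule W)
    moreover have "2 * (\<Sum>i=1..n. x i * \<theta> i) - (\<Sum>i=1..n. (\<theta> i)\<^sup>2)
      \<le> 3 * (2 * (\<Sum>i=1..n. y i * (\<theta> i / 3)) - (\<Sum>i=1..n. (\<theta> i / 3)\<^sup>2)) + 3 / 2 * (\<Sum>i=1..n. (x i - y i)\<^sup>2)"
      unfolding sum_distrib_left sum_subtractf[symmetric] sum.distrib[symmetric]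
    proof (intro sum_mono)
      fix i
      \<comment> \<open>Completing the square; the resulting 3/2, divided by
        \<open>4 * \<sigma>\<^sup>2\<close>, matches the 3/8 of the Gaussian inequality
        exactly.\<close>
      have "0 \<le> (3 * (x i - y i) - 2 * \<theta> i)\<^sup>2 / 6" by simp
      then show "2 * (x i * \<theta> i) - (\<theta> i)\<^sup>2
        \<le> 3 * (2 * (y i * (\<theta> i / 3)) - (\<theta> i / 3)\<^sup>2) + 3 / 2 * (x i - y i)\<^sup>2"
        by (simp add: power2_eq_square field_simps)
    qed
    ultimately show ?thesis by linarith
  qed
  define F G where "F = (\<lambda>\<xi>. ennreal (exp (W \<xi> / (4 * \<sigma>\<^sup>2))))" and "G = (\<lambda>\<xi>. ennreal (exp (- R \<xi> / 4)))"
  have [measurable]: "F \<in> borel_measurable ?M" "G \<in> borel_measurable ?M"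
    unfolding F_def G_def by measurable
  have PL: "(\<integral>\<^sup>+\<xi>. F \<xi> \<partial>?M) * (\<integral>\<^sup>+\<xi>. G \<xi> \<partial>?M) ^ 3 \<le> 1"
    unfolding gaussian_noise_def
  proof (rule prekopa_leindler_gaussian[OF finite_atLeastAtMost \<open>\<sigma> > 0\<close>], fold gaussian_noise_def)
    fix x y :: "nat \<Rightarrow> real"
    have "F x * G y ^ 3 = ennreal (exp (W x / (4 * \<sigma>\<^sup>2)) * exp (- R y / 4) ^ 3)"
      by (simp add: F_def G_def ennreal_mult ennreal_power)
    also have "exp (W x / (4 * \<sigma>\<^sup>2)) * exp (- R y / 4) ^ 3 = exp (W x / (4 * \<sigma>\<^sup>2) - 3 / 4 * R y)"
    proof -
      have "exp (- R y / 4) ^ 3 = exp (3 * (- R y / 4))"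
        by (simp only: exp_of_nat_mult[symmetric] of_nat_numeral)
      then show ?thesis by (simp add: mult_exp_exp)
    qed
    also have "ennreal \<dots> \<le> ennreal (exp (3/8 * (\<Sum>i=1..n. (x i - y i)\<^sup>2) / \<sigma>\<^sup>2))"
    proof -
      have "W x / (4 * \<sigma>\<^sup>2) \<le> (3 * \<sigma>\<^sup>2 * R y + 3 / 2 * (\<Sum>i=1..n. (x i - y i)\<^sup>2)) / (4 * \<sigma>\<^sup>2)"
        by (intro divide_right_mono key) simp
      also have "\<dots> = 3 / 4 * R y + 3/8 * (\<Sum>i=1..n. (x i - y i)\<^sup>2) / \<sigma>\<^sup>2"
        using \<open>\<sigma> > 0\<close> by (simp add: field_simps)
      finally show ?thesis by (intro ennreal_leI) simp
    qed
    finally show "F x * G y ^ 3 \<le> ennreal (exp (3/8 * (\<Sum>i\<in>{1..n}. (x i - y i)\<^sup>2) / \<sigma>\<^sup>2))" .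
  qed measurable
  have "ennreal (exp (- c / 4)) \<le> (\<integral>\<^sup>+\<xi>. G \<xi> \<partial>?M)"
    unfolding G_def by (rule exp_mean_lower_bound[OF prob_space_gaussian_noise[OF \<open>\<sigma> > 0\<close>] R(1)])
  then have "(\<integral>\<^sup>+\<xi>. F \<xi> \<partial>?M) * ennreal (exp (- c / 4)) ^ 3 \<le> (\<integral>\<^sup>+\<xi>. F \<xi> \<partial>?M) * (\<integral>\<^sup>+\<xi>. G \<xi> \<partial>?M) ^ 3"
    by (intro mult_left_mono power_mono) auto
  also note PL
  finally have "(\<integral>\<^sup>+\<xi>. F \<xi> \<partial>?M) * ennreal (exp (- (3 / 4 * c))) \<le> 1"
    by (simp add: ennreal_power flip: exp_of_nat_mult)
  then have "(\<integral>\<^sup>+\<xi>. F \<xi> \<partial>?M) * ennreal (exp (- (3 / 4 * c))) * ennreal (exp (3 / 4 * c)) \<le> 1 * ennreal (exp (3 / 4 * c))"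
    by (rule mult_right_mono) simp
  then show ?thesis
    by (simp add: mult.assoc F_def mult_exp_exp flip: ennreal_mult)
qed

theorem corollary3p3:
  shows "\<exists>c::real. c > 0 \<and>
    (\<forall>(n::nat) (\<mu>::nat \<Rightarrow> real) (\<sigma>::real) (x::real).
       n \<ge> 2 \<longrightarrow> \<mu> \<in> Rn n \<longrightarrow> \<sigma> > 0 \<longrightarrow> x > 0 \<longrightarrow>
       \<P>(\<xi> in gaussian_noise n \<sigma>.
           (scaled_norm n (vdiff n (LSE n (S_up n) (vadd n \<mu> \<xi>)) \<mu>))\<^sup>2
             \<le> min_over (\<lambda>u. (scaled_norm n (vdiff n u \<mu>))\<^sup>2
                   + 2 * c * \<sigma>\<^sup>2 * ((\<sigma> + V n u) / (\<sigma> * real n)) powr (2 / 3)) (S_up n)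
               + 4 * \<sigma>\<^sup>2 * x / real n)
         > 1 - exp (- x))"
proof -
  obtain C where "C \<ge> 1" and C: "\<And>n \<sigma> u. 1 \<le> n \<Longrightarrow> \<sigma> > 0 \<Longrightarrow> u \<in> S_up n \<Longrightarrow>
     \<exists>R. mean_le (gaussian_noise n \<sigma>) (C * (real n * ((\<sigma> + V n u) / (\<sigma> * real n)) powr (2/3))) R \<and>
       (\<forall>\<xi>. \<forall>v\<in>S_up n. 2 * (\<Sum>i=1..n. \<xi> i * (v i - u i)) - (\<Sum>i=1..n. (v i - u i)\<^sup>2) \<le> \<sigma>\<^sup>2 * R \<xi>)"
    using isotonic_envelope by blast
  show ?thesis
  \<comment> \<open>With this witness the penalty is
    \<open>4 * \<sigma>\<^sup>2 * C * m / n\<close>, on the same scale as the deviation term, so the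
    event reads \<open>W \<xi> / (4 * \<sigma>\<^sup>2) \<le> C * m + x\<close>.\<close>
  proof (intro exI[of _ "2 * C"] conjI allI impI)
    show "2 * C > 0" using \<open>C \<ge> 1\<close> by simp
    fix n :: nat and \<mu> :: "nat \<Rightarrow> real" and \<sigma> x :: real
    assume "2 \<le> n" and \<sigma>: "\<sigma> > 0" and "x > 0"
    then have n: "1 \<le> n" by simp
    let ?M = "gaussian_noise n \<sigma>"
    interpret prob_space ?M by (rule prob_space_gaussian_noise[OF \<sigma>])
    define pen where "pen = (\<lambda>t. 2 * (2 * C) * \<sigma>\<^sup>2 * ((\<sigma> + t) / (\<sigma> * real n)) powr (2 / 3))"
    define obj where "obj = (\<lambda>u. (scaled_norm n (vdiff n u \<mu>))\<^sup>2 + pen (V n u))"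
    \<comment> \<open>The oracle depends on \<mu> and \<sigma> only, so a single fixed
      \<open>u\<close> suffices and no union over competitors is taken.\<close>
    define u where "u = arg_min_on obj (S_up n)"
    have u: "u \<in> S_up n"
      unfolding u_def
    proof (rule arg_min_on_S_up(1)[OF n])
      \<comment> \<open>On the cone the variation is the difference of the end values; the absolute
        value extends it continuously with a positive base for the power.\<close>
      let ?F = "\<lambda>v :: nat \<Rightarrow> real. (\<Sum>i=1..n. (v i - \<mu> i)\<^sup>2) / n + pen \<bar>v n - v 1\<bar>"
      have "continuous_on UNIV (\<lambda>v :: nat \<Rightarrow> real. (\<sigma> + \<bar>v n - v 1\<bar>) / (\<sigma> * real n))"
        using \<sigma> n by (intro continuous_intros continuous_on_product_coordinates) auto
      then have "continuous_on UNIV (\<lambda>v :: nat \<Rightarrow> real. ((\<sigma> + \<bar>v n - v 1\<bar>) / (\<sigma> * real n)) powr (2 / 3))"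
        using \<sigma> by (intro continuous_on_powr' continuous_on_const) auto
      then have "continuous_on UNIV (\<lambda>v :: nat \<Rightarrow> real. pen \<bar>v n - v 1\<bar>)"
        unfolding pen_def by (rule continuous_on_mult_left)
      moreover have "continuous_on UNIV (\<lambda>v :: nat \<Rightarrow> real. (\<Sum>i=1..n. (v i - \<mu> i)\<^sup>2) / n)"
        using n by (intro continuous_intros continuous_on_product_coordinates) auto
      ultimately show "continuous_on UNIV ?F"
        by (rule continuous_on_add[rotated])
      show "obj v = ?F v" if "v \<in> S_up n" for v
        using V_S_up[OF that n] S_up_mono[OF that, of 1 n] n
        by (simp add: obj_def scaled_norm_vdiff_sq)
      show "(\<Sum>i=1..n. (v i - \<mu> i)\<^sup>2) / n \<le> obj v" for v
        using \<open>C \<ge> 1\<close> by (simp add: obj_def scaled_norm_vdiff_sq pen_def)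
    qed
    define m where "m = real n * ((\<sigma> + V n u) / (\<sigma> * real n)) powr (2/3)"
    have "m > 0"
    proof -
      have "0 \<le> V n u" using V_S_up[OF u n] S_up_mono[OF u, of 1 n] n by simp
      then show ?thesis using \<sigma> n by (simp add: m_def)
    qed
    obtain R where R: "mean_le ?M (C * m) R"
      "\<And>\<xi> v. v \<in> S_up n \<Longrightarrow> 2 * (\<Sum>i=1..n. \<xi> i * (v i - u i)) - (\<Sum>i=1..n. (v i - u i)\<^sup>2) \<le> \<sigma>\<^sup>2 * R \<xi>"
      using C[OF n \<sigma> u] unfolding m_def by blast
    define p where "p = (\<lambda>\<xi>. LSE n (S_up n) (vadd n \<mu> \<xi>))"
    define W where "W = (\<lambda>\<xi>. (\<Sum>i=1..n. (p \<xi> i - \<mu> i)\<^sup>2) - (\<Sum>i=1..n. (u i - \<mu> i)\<^sup>2))"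
    have "(\<lambda>\<xi>. p \<xi> i) \<in> borel_measurable ?M" if "i \<in> {1..n}" for i
      unfolding p_def borel_measurable_gaussian_noise_iff by (rule LSE_measurable[OF n that])
    then have W_meas [measurable]: "W \<in> borel_measurable ?M"
      unfolding W_def
      by (intro borel_measurable_diff borel_measurable_sum borel_measurable_power borel_measurable_const)
    have W_le: "W \<xi> \<le> 2 * (\<Sum>i=1..n. \<xi> i * (p \<xi> i - u i)) - (\<Sum>i=1..n. (p \<xi> i - u i)\<^sup>2)" for \<xi>
      unfolding W_def p_def by (rule LSE_basic_inequality[OF n u]) (simp add: vadd_def)
    have mgf: "(\<integral>\<^sup>+\<xi>. exp (W \<xi> / (4 * \<sigma>\<^sup>2)) \<partial>?M) \<le> ennreal (exp (3 / 4 * (C * m)))"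
      by (rule isotonic_exp_moment_bound[OF n \<sigma> u R _ W_meas W_le]) (simp_all add: p_def LSE_in_S_up[OF n])
    have event: "(scaled_norm n (vdiff n (p \<xi>) \<mu>))\<^sup>2 \<le> obj u + 4 * \<sigma>\<^sup>2 * x / real n
        \<longleftrightarrow> W \<xi> / (4 * \<sigma>\<^sup>2) \<le> C * m + x" for \<xi>
    proof -
      have "obj u = ((\<Sum>i=1..n. (u i - \<mu> i)\<^sup>2) + 4 * \<sigma>\<^sup>2 * (C * m)) / n"
        using n by (simp add: obj_def scaled_norm_vdiff_sq pen_def m_def add_divide_distrib)
      then show ?thesis
        using n \<sigma> by (simp add: scaled_norm_vdiff_sq W_def field_simps)
    qed
    have tail: "emeasure ?M {\<xi> \<in> space ?M. \<not> W \<xi> / (4 * \<sigma>\<^sup>2) \<le> C * m + x} \<le> ennreal (exp (- (C * m / 4) - x))"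
    proof -
      have "emeasure ?M {\<xi> \<in> space ?M. \<not> W \<xi> / (4 * \<sigma>\<^sup>2) \<le> C * m + x}
          \<le> emeasure ?M {\<xi> \<in> space ?M. 1 \<le> ennreal (exp (- (C * m) - x)) * ennreal (exp (W \<xi> / (4 * \<sigma>\<^sup>2)))}"
      proof (intro emeasure_mono)
        show "{\<xi> \<in> space ?M. \<not> W \<xi> / (4 * \<sigma>\<^sup>2) \<le> C * m + x}
            \<subseteq> {\<xi> \<in> space ?M. 1 \<le> ennreal (exp (- (C * m) - x)) * ennreal (exp (W \<xi> / (4 * \<sigma>\<^sup>2)))}"
          by (auto simp: mult_exp_exp simp flip: ennreal_mult)
      qed measurable
      also have "\<dots> \<le> ennreal (exp (- (C * m) - x)) * (\<integral>\<^sup>+\<xi>. ennreal (exp (W \<xi> / (4 * \<sigma>\<^sup>2))) * indicator (space ?M) \<xi> \<partial>?M)"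
        by (rule nn_integral_Markov_inequality) measurable
      also have "(\<integral>\<^sup>+\<xi>. ennreal (exp (W \<xi> / (4 * \<sigma>\<^sup>2))) * indicator (space ?M) \<xi> \<partial>?M) = (\<integral>\<^sup>+\<xi>. exp (W \<xi> / (4 * \<sigma>\<^sup>2)) \<partial>?M)"
        by (intro nn_integral_cong) simp
      also have "ennreal (exp (- (C * m) - x)) * (\<integral>\<^sup>+\<xi>. exp (W \<xi> / (4 * \<sigma>\<^sup>2)) \<partial>?M)
          \<le> ennreal (exp (- (C * m) - x)) * ennreal (exp (3 / 4 * (C * m)))"
        by (intro mult_left_mono mgf) simp
      also have "\<dots> = ennreal (exp (- (C * m / 4) - x))"
        by (simp add: mult_exp_exp flip: ennreal_mult)
      finally show ?thesis .
    qed
    have "prob {\<xi> \<in> space ?M. \<not> W \<xi> / (4 * \<sigma>\<^sup>2) \<le> C * m + x} \<le> exp (- (C * m / 4) - x)"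
      using tail by (simp add: emeasure_eq_measure)
    also have "\<dots> < exp (- x)" using \<open>m > 0\<close> \<open>C \<ge> 1\<close> by simp
    finally have "1 - exp (- x) < 1 - prob {\<xi> \<in> space ?M. \<not> W \<xi> / (4 * \<sigma>\<^sup>2) \<le> C * m + x}"
      by simp
    also have "\<dots> = \<P>(\<xi> in ?M. W \<xi> / (4 * \<sigma>\<^sup>2) \<le> C * m + x)"
      by (subst prob_neg) auto
    also have "\<dots> = \<P>(\<xi> in ?M. (scaled_norm n (vdiff n (p \<xi>) \<mu>))\<^sup>2 \<le> obj u + 4 * \<sigma>\<^sup>2 * x / real n)"
      by (simp only: event)
    finally show "\<P>(\<xi> in gaussian_noise n \<sigma>.
           (scaled_norm n (vdiff n (LSE n (S_up n) (vadd n \<mu> \<xi>)) \<mu>))\<^sup>2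
             \<le> min_over (\<lambda>u. (scaled_norm n (vdiff n u \<mu>))\<^sup>2
                   + 2 * (2 * C) * \<sigma>\<^sup>2 * ((\<sigma> + V n u) / (\<sigma> * real n)) powr (2 / 3)) (S_up n)
               + 4 * \<sigma>\<^sup>2 * x / real n)
         > 1 - exp (- x)"
      unfolding min_over_def p_def u_def obj_def pen_def .
  qed
qed

end
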